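(* Let $M$ be a countable structure and $\mathrm{cl}$ an invariant, finitary closure operation on $M$ which subsumes definable closure. Suppose that $\downarrow$ is a stationary independence relation on $M$ compatible with $\mathrm{cl}$ and that $G=\mathrm{Aut}(M)$ fixes every element of $\mathrm{cl}(\emptyset)$. If $g\in G$ moves almost maximally, then every element of $G$ is a product of 16 conjugates of $g$.
   Context: $M$ is a first-order structure, $G=\mathrm{Aut}(M)$, and for $X\subseteq M$, $G_X=\{g\in G: g(x)=x\ \forall x\in X\}$. A closure operation $\mathrm{cl}$ on $M$ is invariant if $\mathrm{cl}(gX)=g(\mathrm{cl}(X))$ for all $g\in G$, $X\subseteq M$; finitary if $\mathrm{cl}(X)=\bigcup\{\mathrm{cl}(Y):Y\subseteq X\text{ finite}\}$ for all $X\subseteq M$; it subsumes definable closure if whenever $X\subseteq M$ is finite and $a\in M$ is fixed by $G_{\mathrm{cl}(X)}$, then $a\in\mathrm{cl}(X)$. Let $\mathcal{X}=\{\mathrm{cl}(X):X\subseteq M\text{ finite}\}$ and let $\mathcal{F}$ be the set of all bijections $f:A\to B$ with $A,B\in\mathcal{X}$ which extend to elements of $G$. Juxtaposition denotes union (e.g. $CD=C\cup D$), tuples are identified with their sets of entries where appropriate, and $\mathrm{cl}(a,B)=\mathrm{cl}(\{a\}\cup B)$. A ternary relation $A\downarrow_B C$ between elements of $\mathcal{X}$ (or more generally subsets of elements of $\mathcal{X}$, in particular finite tuples) is a stationary independence relation compatible with $\mathrm{cl}$ if for all $A,B,C,D\in\mathcal{X}$ and finite tuples $a,b$: (1) (Compatibility)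 $a\downarrow_b C\Leftrightarrow a\downarrow_{\mathrm{cl}(b)}C$, and $a\downarrow_B C\Leftrightarrow (e\downarrow_B C\text{ for all }e\in\mathrm{cl}(a,B))\Leftrightarrow \mathrm{cl}(a,B)\downarrow_B C$. (2) (Invariance) If $g\in G$ and $A\downarrow_B C$, then $gA\downarrow_{gB}gC$. (3) (Monotonicity) If $A\downarrow_B CD$, then $A\downarrow_B C$ and $A\downarrow_{BC}D$. (4) (Transitivity) If $A\downarrow_B C$ and $A\downarrow_{BC}D$, then $A\downarrow_B CD$. (5) (Symmetry) If $A\downarrow_B C$, then $C\downarrow_B A$. (6) (Existence) There is $g\in G_B$ with $gA\downarrow_B C$. (7) (Stationarity) Suppose $A_1,A_2,B,C\in\mathcal{X}$ with $B\subseteq A_i$ and $A_i\downarrow_B C$ for $i=1,2$. Suppose $h:A_1\to A_2$ is the identity on $B$ and $h\in\mathcal{F}$. Then there is some $k\in\mathcal{F}$ which contains $h\cup\mathrm{id}_C$. An element $g\in G$ moves almost maximally if for all $B\in\mathcal{X}$ and all elements $a\in M$ there is $a'$ in the $G_B$-orbit of $a$ such that $a'\downarrow_B ga'$. Conjugates are taken in $G$. *)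

theory Defs
  imports Complex_Main "HOL-Library.Countable"
begin

(* The universe of a structure is the whole type 'a. Constants are functions of arity 0, and
   the interpretations matter only on argument lists whose length is the arity of the symbol. *)
record ('a, 'f, 'r) fo_structure =
  fun_arity :: "'f \<Rightarrow> nat"
  rel_arity :: "'r \<Rightarrow> nat"
  fun_interp :: "'f \<Rightarrow> 'a list \<Rightarrow> 'a"
  rel_interp :: "'r \<Rightarrow> 'a list \<Rightarrow> bool"

definition Aut :: "('a, 'f, 'r) fo_structure \<Rightarrow> ('a \<Rightarrow> 'a) set" where
  "Aut M = {g. bij g
     \<and> (\<forall>s xs. length xs = fun_arity M s \<longrightarrow> fun_interp M s (map g xs) = g (fun_interp M s xs))
     \<and> (\<forall>r xs. length xs = rel_arity M r \<longrightarrow> rel_interp M r (map g xs) = rel_interp M r xs)}"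

definition fixator :: "('a, 'f, 'r) fo_structure \<Rightarrow> 'a set \<Rightarrow> ('a \<Rightarrow> 'a) set" where
  "fixator M X = {g \<in> Aut M. \<forall>x\<in>X. g x = x}"

definition closure_operation :: "('a set \<Rightarrow> 'a set) \<Rightarrow> bool" where
  "closure_operation cl \<longleftrightarrow>
     (\<forall>X. X \<subseteq> cl X) \<and> (\<forall>X Y. X \<subseteq> Y \<longrightarrow> cl X \<subseteq> cl Y) \<and> (\<forall>X. cl (cl X) = cl X)"

definition invariant_closure :: "('a, 'f, 'r) fo_structure \<Rightarrow> ('a set \<Rightarrow> 'a set) \<Rightarrow> bool" where
  "invariant_closure M cl \<longleftrightarrow> (\<forall>g\<in>Aut M. \<forall>X. cl (g ` X) = g ` cl X)"

definition finitary_closure :: "('a set \<Rightarrow> 'a set) \<Rightarrow> bool" where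
  "finitary_closure cl \<longleftrightarrow> (\<forall>X. cl X = \<Union> {cl Y | Y. Y \<subseteq> X \<and> finite Y})"

definition subsumes_dcl :: "('a, 'f, 'r) fo_structure \<Rightarrow> ('a set \<Rightarrow> 'a set) \<Rightarrow> bool" where
  "subsumes_dcl M cl \<longleftrightarrow>
     (\<forall>X a. finite X \<and> (\<forall>g\<in>fixator M (cl X). g a = a) \<longrightarrow> a \<in> cl X)"

definition fin_closures :: "('a set \<Rightarrow> 'a set) \<Rightarrow> 'a set set" where
  "fin_closures cl = {cl X | X. finite X}"

(* The set of maps written as a calligraphic F in the literature; a map is its graph. *)
definition partial_auts ::
  "('a, 'f, 'r) fo_structure \<Rightarrow> ('a set \<Rightarrow> 'a set) \<Rightarrow> ('a \<times> 'a) set set" where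
  "partial_auts M cl = {{(x, f x) | x. x \<in> A} | f A.
     A \<in> fin_closures cl \<and> (\<exists>B\<in>fin_closures cl. bij_betw f A B) \<and>
     (\<exists>g\<in>Aut M. \<forall>x\<in>A. g x = f x)}"

(* Finite tuples enter only through their sets of entries, so they are finite sets. *)
definition indep_args :: "('a set \<Rightarrow> 'a set) \<Rightarrow> 'a set set" where
  "indep_args cl = fin_closures cl \<union> {a. finite a}"

(* ind A B C reads "A is independent from C over B".

   The relation is used both for finitely generated closed sets and for finite tuples (see
   moves_almost_maximally, where the third argument is a single element), so the axioms range
   over both kinds of sets; stationarity is about closed sets only. Unions such as B \<union> C need
   be of neither kind.

   In compatibility, e ranges over the finite tuples of elements of cl (a \<union> B), not only over
   the single elements: independence of a set is not determined by its elements (think of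
   linear independence of points in a nonmodular pregeometry). *)
definition stationary_independence ::
  "('a, 'f, 'r) fo_structure \<Rightarrow> ('a set \<Rightarrow> 'a set)
     \<Rightarrow> ('a set \<Rightarrow> 'a set \<Rightarrow> 'a set \<Rightarrow> bool) \<Rightarrow> bool" where
  "stationary_independence M cl ind \<longleftrightarrow>
     \<comment> \<open>compatibility\<close>
     (\<forall>a b. \<forall>C\<in>indep_args cl. finite a \<and> finite b \<longrightarrow>
        (ind a b C \<longleftrightarrow> ind a (cl b) C)) \<and>
     (\<forall>a. \<forall>B\<in>indep_args cl. \<forall>C\<in>indep_args cl. finite a \<longrightarrow>
        (ind a B C \<longleftrightarrow> (\<forall>e. finite e \<and> e \<subseteq> cl (a \<union> B) \<longrightarrow> ind e B C)) \<and>
        (ind a B C \<longleftrightarrow> ind (cl (a \<union> B)) B C)) \<and>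
     \<comment> \<open>invariance\<close>
     (\<forall>g\<in>Aut M. \<forall>A\<in>indep_args cl. \<forall>B\<in>indep_args cl. \<forall>C\<in>indep_args cl.
        ind A B C \<longrightarrow> ind (g ` A) (g ` B) (g ` C)) \<and>
     \<comment> \<open>monotonicity\<close>
     (\<forall>A\<in>indep_args cl. \<forall>B\<in>indep_args cl. \<forall>C\<in>indep_args cl. \<forall>D\<in>indep_args cl.
        ind A B (C \<union> D) \<longrightarrow> ind A B C \<and> ind A (B \<union> C) D) \<and>
     \<comment> \<open>transitivity\<close>
     (\<forall>A\<in>indep_args cl. \<forall>B\<in>indep_args cl. \<forall>C\<in>indep_args cl. \<forall>D\<in>indep_args cl.
        ind A B C \<and> ind A (B \<union> C) D \<longrightarrow> ind A B (C \<union> D)) \<and>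
     \<comment> \<open>symmetry\<close>
     (\<forall>A\<in>indep_args cl. \<forall>B\<in>indep_args cl. \<forall>C\<in>indep_args cl. ind A B C \<longrightarrow> ind C B A) \<and>
     \<comment> \<open>existence\<close>
     (\<forall>A\<in>indep_args cl. \<forall>B\<in>indep_args cl. \<forall>C\<in>indep_args cl.
        \<exists>g\<in>fixator M B. ind (g ` A) B C) \<and>
     \<comment> \<open>stationarity\<close>
     (\<forall>A1\<in>fin_closures cl. \<forall>A2\<in>fin_closures cl. \<forall>B\<in>fin_closures cl. \<forall>C\<in>fin_closures cl.
        \<forall>h\<in>partial_auts M cl.
          B \<subseteq> A1 \<and> B \<subseteq> A2 \<and> ind A1 B C \<and> ind A2 B C \<and>
          Domain h = A1 \<and> Range h = A2 \<and> Id_on B \<subseteq> h \<longrightarrow>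
          (\<exists>k\<in>partial_auts M cl. h \<union> Id_on C \<subseteq> k))"

definition moves_almost_maximally ::
  "('a, 'f, 'r) fo_structure \<Rightarrow> ('a set \<Rightarrow> 'a set)
     \<Rightarrow> ('a set \<Rightarrow> 'a set \<Rightarrow> 'a set \<Rightarrow> bool) \<Rightarrow> ('a \<Rightarrow> 'a) \<Rightarrow> bool" where
  "moves_almost_maximally M cl ind g \<longleftrightarrow>
     (\<forall>B\<in>fin_closures cl. \<forall>a. \<exists>a' \<in> {h a | h. h \<in> fixator M B}. ind {a'} B {g a'})"

definition conjugates :: "('a, 'f, 'r) fo_structure \<Rightarrow> ('a \<Rightarrow> 'a) \<Rightarrow> ('a \<Rightarrow> 'a) set" where
  "conjugates M g = {h \<circ> g \<circ> inv h | h. h \<in> Aut M}"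

end

theory Submission
  imports Defs
begin

text \<open>
  The idea is that of Tent and Ziegler: show that a product of four conjugates of \<open>g\<close> can be
  prescribed on arbitrary finite sets once the conjugators are known well enough, and then build
  a factorisation of a given automorphism by back and forth.

  All sets that carry independence are kept finite, because finite sets are closed under union,
  while the group acts through pointwise stabilisers \<open>Fix X\<close> of closures \<open>cl X\<close>.
  Stationarity turns independence into freedom to choose among the automorphisms that agree with
  a given one on \<open>cl X\<close>.

  A conjugate of \<open>g\<close> is varied by conjugating it with some \<open>a\<close> that fixes \<open>cl (X \<union> g ` X)\<close>;
  this keeps its values on \<open>cl X\<close>. Since \<open>g\<close> moves points almost maximally, it moves finite
  sets \<open>x\<close> over \<open>X\<close>, up to the action of \<open>Fix X\<close>, so that \<open>x\<close> and \<open>g ` x\<close> are independent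
  over \<open>X\<close> and \<open>g ` X\<close> simultaneously (\<open>moves_maximallyI\<close>). Consequently the conjugate can be
  made to take any prescribed values on \<open>x\<close> that are independent in this sense and have the right
  type over \<open>g ` X\<close> (\<open>conjugate_prescribed\<close>).

  With one conjugate both \<open>x\<close> and its image are given, and they need not be independent of
  anything. Four conjugates in a row leave room: the first and the last are used to make the
  image, respectively the preimage, of the given sets independent of the middle of the chain
  (\<open>conjugate_independent\<close>, \<open>conjugate_inv_independent\<close>), and then the two conjugates in the
  middle are joined through a free point (\<open>four_conjugates\<close>). This needs two independence
  conditions on the finite sets along the chain, and every chain can be enlarged to one that
  satisfies them (\<open>good_exists\<close>).

  In topological language, the image of the map sending four conjugators to the product of the
  conjugates is comeagre in the group, so that every \<open>f\<close> is a product of two elements of the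
  image. The back and forth (\<open>factoring_step\<close>) constructs these two elements directly: two chains
  whose composite is \<open>f\<close> are enlarged in turn. The identity of \<open>cl {}\<close> is where it starts, which
  is why the group has to fix that set pointwise. So every automorphism is a product of eight
  conjugates; applying this to \<open>f\<close> composed with the inverse of the eighth power of \<open>g\<close> gives
  exactly sixteen.
\<close>

section \<open>Automorphisms\<close>

lemma Aut_bij: "u \<in> Aut M \<Longrightarrow> bij u"
  by (simp add: Aut_def)

lemma Aut_id: "id \<in> Aut M"
  by (simp add: Aut_def)

lemma Aut_comp: "u \<in> Aut M \<Longrightarrow> v \<in> Aut M \<Longrightarrow> u \<circ> v \<in> Aut M"
  by (simp add: Aut_def bij_comp flip: map_map)

lemma Aut_inv:
  assumes "u \<in> Aut M"
  shows "inv u \<in> Aut M"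
proof -
  have b: "bij u" using assms by (rule Aut_bij)
  have m: "map u (map (inv u) xs) = xs" for xs
    using b by (simp add: map_idI surj_f_inv_f bij_is_surj)
  have "fun_interp M s (map (inv u) xs) = inv u (fun_interp M s xs)"
    if "length xs = fun_arity M s" for s xs
  proof -
    have "u (fun_interp M s (map (inv u) xs)) = fun_interp M s (map u (map (inv u) xs))"
      using assms that by (simp add: Aut_def del: map_map)
    then show ?thesis
      using b m by (metis bij_inv_eq_iff)
  qed
  moreover have "rel_interp M r (map (inv u) xs) = rel_interp M r xs"
    if "length xs = rel_arity M r" for r xs
  proof -
    have "rel_interp M r (map u (map (inv u) xs)) = rel_interp M r (map (inv u) xs)"
      using assms that by (simp add: Aut_def del: map_map)
    then show ?thesis by (simp add: m del: map_map)
  qed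
  ultimately show ?thesis using b by (simp add: Aut_def bij_imp_bij_inv)
qed

lemma Aut_inv_apply [simp]:
  assumes "u \<in> Aut M"
  shows "inv u (u x) = x" "u (inv u x) = x"
  using Aut_bij[OF assms] by (simp_all add: bij_is_inj bij_is_surj surj_f_inv_f)

lemma Aut_inv_image [simp]:
  assumes "u \<in> Aut M"
  shows "inv u ` u ` X = X" "u ` inv u ` X = X"
  using assms by (simp_all add: image_image)

lemma Aut_inj_eq: "u \<in> Aut M \<Longrightarrow> u x = u y \<longleftrightarrow> x = y"
  by (metis Aut_inv_apply(1))

text \<open>The automorphism group is closed under pointwise limits, since each instance of the
  defining conditions involves finitely many points. That the limit is onto is not automatic: it
  needs the images of the sets \<open>S n\<close> to exhaust the structure as well.\<close>

lemma Aut_limit: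
  assumes u: "\<And>n. u n \<in> Aut M"
    and mono: "\<And>n. S n \<subseteq> S (Suc n)"
    and agree: "\<And>n x. x \<in> S n \<Longrightarrow> u (Suc n) x = u n x"
    and dom: "\<And>z. \<exists>n. z \<in> S n"
    and ran: "\<And>z. \<exists>n. z \<in> u n ` S n"
  shows "\<exists>v\<in>Aut M. \<forall>n. \<forall>x\<in>S n. v x = u n x"
proof -
  have S_mono: "S m \<subseteq> S n" if "m \<le> n" for m n
    using mono that by (rule lift_Suc_mono_le)
  have later: "u n x = u m x" if "m \<le> n" "x \<in> S m" for m n x
    using that
  proof (induction n rule: dec_induct)
    case (step n)
    then show ?case using agree S_mono by (metis subsetD)
  qed simp
  define v where "v x = u (LEAST n. x \<in> S n) x" for x
  have v: "v x = u n x" if "x \<in> S n" for n x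
    unfolding v_def using later[OF Least_le[of "\<lambda>n. x \<in> S n", OF that]]
      LeastI[of "\<lambda>n. x \<in> S n", OF that] by simp
  have fin: "\<exists>n. F \<subseteq> S n" if "finite F" for F
    using that
  proof induction
    case (insert x F)
    then obtain m n where "F \<subseteq> S m" "x \<in> S n" using dom by blast
    then have "insert x F \<subseteq> S (max m n)"
      using S_mono[of m "max m n"] S_mono[of n "max m n"] by auto
    then show ?case by blast
  qed simp
  have "x = y" if eq: "v x = v y" for x y
  proof -
    obtain n where "x \<in> S n" "y \<in> S n" using fin[of "{x, y}"] by blast
    then have "u n x = u n y" using eq v[of x n] v[of y n] by simp
    then show ?thesis using Aut_inj_eq[OF u] by blast
  qed
  moreover have "\<exists>x. z = v x" for z
  proof -
    obtain n x where "z = u n x" "x \<in> S n" using ran[of z] by blast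
    then have "z = v x" using v[of x n] by simp
    then show ?thesis by blast
  qed
  ultimately have "bij v" by (simp add: bij_def inj_def surj_def)
  moreover have "fun_interp M s (map v xs) = v (fun_interp M s xs)"
    if len: "length xs = fun_arity M s" for s xs
  proof -
    obtain n where n: "insert (fun_interp M s xs) (set xs) \<subseteq> S n"
      using fin[of "insert (fun_interp M s xs) (set xs)"] by blast
    then have "map v xs = map (u n) xs" by (auto intro!: v)
    moreover have "v (fun_interp M s xs) = u n (fun_interp M s xs)" using n by (auto intro!: v)
    moreover have "fun_interp M s (map (u n) xs) = u n (fun_interp M s xs)"
      using u[of n] len by (simp add: Aut_def)
    ultimately show ?thesis by (simp only:)
  qed
  moreover have "rel_interp M r (map v xs) = rel_interp M r xs"
    if len: "length xs = rel_arity M r" for r xs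
  proof -
    obtain n where n: "set xs \<subseteq> S n" using fin[of "set xs"] by blast
    then have "map v xs = map (u n) xs" by (auto intro!: v)
    moreover have "rel_interp M r (map (u n) xs) = rel_interp M r xs"
      using u[of n] len by (simp add: Aut_def)
    ultimately show ?thesis by (simp only:)
  qed
  ultimately have "v \<in> Aut M" by (simp add: Aut_def)
  then show ?thesis using v by blast
qed

section \<open>Independence of finite sets\<close>

locale independent_structure =
  fixes M :: "('a, 'f, 'r) fo_structure"
    and cl :: "'a set \<Rightarrow> 'a set"
    and ind :: "'a set \<Rightarrow> 'a set \<Rightarrow> 'a set \<Rightarrow> bool"
  assumes cl_op: "closure_operation cl"
    and cl_inv: "invariant_closure M cl"
    and stat: "stationary_independence M cl ind"
begin

abbreviation "G \<equiv> Aut M"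

abbreviation "Fix X \<equiv> fixator M (cl X)"

lemma cl_ext: "X \<subseteq> cl X" and cl_mono: "X \<subseteq> Y \<Longrightarrow> cl X \<subseteq> cl Y" and cl_idem: "cl (cl X) = cl X"
  using cl_op by (auto simp: closure_operation_def)

lemma cl_least: "X \<subseteq> cl Y \<Longrightarrow> cl X \<subseteq> cl Y"
  using cl_mono cl_idem by metis

lemma cl_image: "u \<in> G \<Longrightarrow> u ` cl X = cl (u ` X)"
  using cl_inv by (simp add: invariant_closure_def)

lemma cl_imageI: "u \<in> G \<Longrightarrow> x \<in> cl X \<Longrightarrow> u ` X \<subseteq> Y \<Longrightarrow> u x \<in> cl Y"
  using cl_image[of u X] cl_mono[of "u ` X" Y] by blast

lemma FixD: "u \<in> Fix X \<Longrightarrow> u \<in> G"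
  by (simp add: fixator_def)

lemma Fix_apply: "u \<in> Fix X \<Longrightarrow> x \<in> cl X \<Longrightarrow> u x = x"
  by (simp add: fixator_def)

lemma Fix_comp: "u \<in> Fix X \<Longrightarrow> v \<in> Fix X \<Longrightarrow> u \<circ> v \<in> Fix X"
  by (simp add: fixator_def Aut_comp)

lemma Fix_inv: "u \<in> Fix X \<Longrightarrow> inv u \<in> Fix X"
  by (auto simp: fixator_def Aut_inv) (metis Aut_inv_apply(1))

lemma Fix_mono: "u \<in> Fix X \<Longrightarrow> Y \<subseteq> cl X \<Longrightarrow> u \<in> Fix Y"
  using cl_least[of Y X] by (auto simp: fixator_def)

lemma Fix_image: "u \<in> Fix X \<Longrightarrow> Y \<subseteq> cl X \<Longrightarrow> u ` Y = Y"
  by (force simp: fixator_def image_def)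

text \<open>Carrying finiteness inside the relation lets the rules below apply without side
  conditions. A union of finite sets is again a legal argument of \<^term>\<open>ind\<close>, whereas a union
  of two closed sets need be neither closed nor finite.\<close>

definition indep :: "'a set \<Rightarrow> 'a set \<Rightarrow> 'a set \<Rightarrow> bool" where
  "indep a b c \<longleftrightarrow> finite a \<and> finite b \<and> finite c \<and> ind a b c"

lemma indep_finite: "indep a b c \<Longrightarrow> finite a \<and> finite b \<and> finite c"
  by (simp add: indep_def)

lemma indep_args_finite: "finite a \<Longrightarrow> a \<in> indep_args cl"
  by (simp add: indep_args_def)

lemma indep_args_cl: "finite a \<Longrightarrow> cl a \<in> indep_args cl"
  by (auto simp: indep_args_def fin_closures_def)

lemmas ind_axioms = stat[unfolded stationary_independence_def]
lemmas ind_axioms_from_invariance = ind_axioms[THEN conjunct2, THEN conjunct2]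
lemmas ind_axioms_from_transitivity = ind_axioms_from_invariance[THEN conjunct2, THEN conjunct2]
lemmas ind_axioms_from_existence = ind_axioms_from_transitivity[THEN conjunct2, THEN conjunct2]

lemmas ind_compat_base = ind_axioms[THEN conjunct1, rule_format]
lemmas ind_compat_left = ind_axioms[THEN conjunct2, THEN conjunct1, rule_format]
lemmas ind_invariant = ind_axioms_from_invariance[THEN conjunct1, rule_format]
lemmas ind_monotone = ind_axioms_from_invariance[THEN conjunct2, THEN conjunct1, rule_format]
lemmas ind_transitive = ind_axioms_from_transitivity[THEN conjunct1, rule_format]
lemmas ind_symmetric = ind_axioms_from_transitivity[THEN conjunct2, THEN conjunct1, rule_format]
lemmas ind_existence = ind_axioms_from_existence[THEN conjunct1, rule_format]
lemmas ind_stationary = ind_axioms_from_existence[THEN conjunct2, rule_format]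

lemma ind_left_cl:
  assumes "finite a" "B \<in> indep_args cl" "C \<in> indep_args cl"
  shows "ind a B C \<longleftrightarrow> ind (cl (a \<union> B)) B C"
  using ind_compat_left[OF assms(2,3,1)] by blast

lemma ind_left_sub:
  assumes "finite a" "B \<in> indep_args cl" "C \<in> indep_args cl" "ind a B C"
    and "finite e" "e \<subseteq> cl (a \<union> B)"
  shows "ind e B C"
  using ind_compat_left[OF assms(2,3,1)] assms(4-6) by blast

lemma indep_sym: "indep a b c \<Longrightarrow> indep c b a"
  using ind_symmetric indep_args_finite by (simp add: indep_def)

lemma indep_image:
  assumes "indep a b c" "u \<in> G"
  shows "indep (u ` a) (u ` b) (u ` c)"
  using assms ind_invariant[of u a b c] indep_args_finite by (simp add: indep_def)

lemma indep_left_sub: "indep a b c \<Longrightarrow> finite e \<Longrightarrow> e \<subseteq> cl (a \<union> b) \<Longrightarrow> indep e b c"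
  using ind_left_sub[of a b c e] indep_args_finite by (simp add: indep_def)

lemma indep_right_sub: "indep a b c \<Longrightarrow> finite e \<Longrightarrow> e \<subseteq> cl (b \<union> c) \<Longrightarrow> indep a b e"
  by (metis indep_left_sub indep_sym sup_commute)

lemma indep_mono: "indep a b c \<Longrightarrow> a' \<subseteq> a \<union> b \<Longrightarrow> c' \<subseteq> b \<union> c \<Longrightarrow> indep a' b c'"
  using indep_left_sub[OF indep_right_sub, of a b c c' a'] indep_finite[of a b c]
    cl_ext[of "a \<union> b"] cl_ext[of "b \<union> c"]
  by (meson finite_UnI finite_subset order_trans)

text \<open>Monotonicity and transitivity, here and in the next lemmas, are stated with inclusions
  instead of literal unions, so that in applications only set inclusions remain to be checked.\<close>

lemma indep_base:
  assumes "indep a b c" "b \<subseteq> b'" "b' \<subseteq> b \<union> c" "d \<subseteq> b \<union> c"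
  shows "indep a b' d"
proof -
  have 1: "indep a b (b' \<union> d)" using assms indep_mono[of a b c a "b' \<union> d"] by blast
  have "ind a (b \<union> b') d"
    using 1 ind_monotone[of a b b' d] indep_args_finite by (simp add: indep_def)
  then show ?thesis using 1 assms(2) by (simp add: indep_def Un_absorb1)
qed

lemma indep_trans:
  assumes "indep a b c" "indep a b' d" "b \<subseteq> b'" "b' \<subseteq> b \<union> c" "e \<subseteq> b' \<union> d"
  shows "indep a b e"
proof -
  have 1: "indep a b b'" using assms indep_mono[of a b c a b'] by blast
  have "ind a b (b' \<union> d)"
    using 1 assms(2,3) ind_transitive[of a b b' d] indep_args_finite by (simp add: indep_def Un_absorb1)
  then have "indep a b (b' \<union> d)" using 1 assms(2) by (simp add: indep_def)
  then show ?thesis using assms(5) indep_mono[of a b "b' \<union> d" a e] by blast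
qed

lemma indep_trans_left:
  assumes "indep a b c" "indep d b' c" "b \<subseteq> b'" "b' \<subseteq> b \<union> a" "e \<subseteq> b' \<union> d"
  shows "indep e b c"
  using indep_trans[OF assms(1,2)[THEN indep_sym] assms(3-5)] by (rule indep_sym)

text \<open>Existence is used over the closed base, which gives an automorphism fixing all of
  \<^term>\<open>cl b\<close>; compatibility then allows the finite base \<^term>\<open>b\<close> in the independence.\<close>

lemma indep_exists:
  assumes "finite a" "finite b" "finite c"
  shows "\<exists>u\<in>Fix b. indep (u ` a) b c"
proof -
  from ind_existence[OF indep_args_finite[OF assms(1)] indep_args_cl[OF assms(2)]
      indep_args_finite[OF assms(3)]]
  obtain u where "u \<in> Fix b" "ind (u ` a) (cl b) c" by blast
  then show ?thesis
    using assms ind_compat_base indep_args_finite by (auto simp: indep_def)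
qed

lemma indep_over_self:
  assumes "finite a" "finite b"
  shows "indep a b b"
proof -
  obtain u where u: "u \<in> Fix b" "indep (u ` a) b b"
    using indep_exists assms by blast
  have "inv u ` b = b" using Fix_image[OF Fix_inv[OF u(1)] cl_ext] .
  then show ?thesis
    using indep_image[OF u(2) Aut_inv[OF FixD[OF u(1)]]] u(1)[THEN FixD] by simp
qed

text \<open>This is how stationarity is used: if \<^term>\<open>a\<close> and its copy \<open>u ` a\<close> are both independent
  from \<^term>\<open>c\<close>, then \<^term>\<open>u\<close> may be replaced by an automorphism that moves \<^term>\<open>a\<close> in the
  same way and in addition fixes \<^term>\<open>c\<close>. Compatibility carries the independence over to the
  closures \<^term>\<open>cl (a \<union> b)\<close>, \<^term>\<open>cl b\<close> and \<^term>\<open>cl (b \<union> c)\<close>, to which the axiom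
  applies.\<close>

lemma indep_stationary:
  assumes a: "indep a b c" and ua: "indep (u ` a) b c" and u: "u \<in> Fix b"
  shows "\<exists>v\<in>Fix (b \<union> c). \<forall>x\<in>cl (a \<union> b). v x = u x"
proof -
  have uG: "u \<in> G" using u by (rule FixD)
  have fin: "finite a" "finite b" "finite c" using a by (simp_all add: indep_def)
  have closed: "ind (cl (e \<union> b)) (cl b) (cl (b \<union> c))" if e: "indep e b c" for e
  proof -
    have fe: "finite e" using e by (simp add: indep_def)
    have "ind c b e" using e indep_sym by (simp add: indep_def)
    then have "ind (cl (c \<union> b)) b e"
      using ind_left_cl[of c b e] fin fe indep_args_finite by simp
    then have "ind e b (cl (b \<union> c))"
      using ind_symmetric[of "cl (c \<union> b)" b e] fin fe indep_args_finite indep_args_cl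
      by (simp add: Un_commute)
    then have "ind e (cl b) (cl (b \<union> c))"
      using ind_compat_base[of "cl (b \<union> c)" e b] fin fe indep_args_cl by simp
    then have "ind (cl (e \<union> cl b)) (cl b) (cl (b \<union> c))"
      using ind_left_cl[of e "cl b" "cl (b \<union> c)"] fin fe indep_args_cl by simp
    moreover have "cl (e \<union> cl b) = cl (e \<union> b)"
    proof
      show "cl (e \<union> cl b) \<subseteq> cl (e \<union> b)"
        using cl_ext[of "e \<union> b"] cl_mono[of b "e \<union> b"] by (intro cl_least) auto
      show "cl (e \<union> b) \<subseteq> cl (e \<union> cl b)"
        using cl_ext[of b] by (intro cl_mono) auto
    qed
    ultimately show ?thesis by simp
  qed
  have ub: "u ` b = b" using Fix_image[OF u cl_ext] .
  have img: "u ` cl (a \<union> b) = cl (u ` a \<union> b)"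
    using cl_image[OF uG, of "a \<union> b"] by (simp add: image_Un ub)
  define h where "h = {(x, u x) | x. x \<in> cl (a \<union> b)}"
  have cls: "cl (a \<union> b) \<in> fin_closures cl" "cl (u ` a \<union> b) \<in> fin_closures cl"
    "cl b \<in> fin_closures cl" "cl (b \<union> c) \<in> fin_closures cl"
    using fin by (auto simp: fin_closures_def)
  have "bij_betw u (cl (a \<union> b)) (cl (u ` a \<union> b))"
    unfolding img[symmetric] using Aut_inj_eq[OF uG] by (auto simp: bij_betw_def inj_on_def)
  then have hF: "h \<in> partial_auts M cl"
    unfolding h_def partial_auts_def using cls uG by blast
  have hd: "Domain h = cl (a \<union> b)" "Range h = cl (u ` a \<union> b)"
    unfolding h_def img[symmetric] by auto
  have idh: "Id_on (cl b) \<subseteq> h"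
    using Fix_apply[OF u] cl_mono[of b "a \<union> b"] unfolding h_def by force
  have cls_b: "cl b \<subseteq> cl (a \<union> b)" "cl b \<subseteq> cl (u ` a \<union> b)" by (auto intro!: cl_mono)
  from ind_stationary[OF cls hF] idh cls_b hd closed[OF a] closed[OF ua]
  obtain k where k: "k \<in> partial_auts M cl" "h \<union> Id_on (cl (b \<union> c)) \<subseteq> k"
    by blast
  then obtain f A v where kf: "k = {(x, f x) | x. x \<in> A}" and v: "v \<in> G" "\<forall>x\<in>A. v x = f x"
    unfolding partial_auts_def by blast
  have kv: "(x, y) \<in> k \<Longrightarrow> v x = y" for x y using kf v by auto
  have "v x = u x" if "x \<in> cl (a \<union> b)" for x
    using that k(2) kv unfolding h_def by blast
  moreover have "v x = x" if "x \<in> cl (b \<union> c)" for x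
    using that k(2) kv by blast
  ultimately show ?thesis using v(1) by (auto simp: fixator_def)
qed

section \<open>Moving finite sets maximally\<close>

text \<open>The two independences say that \<open>u ` x\<close> and \<open>k ` u ` x\<close> are as independent as possible
  when \<open>u ` x\<close> is considered over \<^term>\<open>X\<close> and its image over \<open>k ` X\<close>. They are symmetric under
  exchanging \<open>k\<close> with its inverse. Tuples are represented by finite sets on which \<^term>\<open>u\<close> acts.\<close>

definition moves_maximally :: "('a \<Rightarrow> 'a) \<Rightarrow> bool" where
  "moves_maximally k \<longleftrightarrow> (\<forall>X x. finite X \<longrightarrow> finite x \<longrightarrow>
     (\<exists>u\<in>Fix X. indep (u ` x) X (k ` X \<union> k ` u ` x) \<and> indep (X \<union> u ` x) (k ` X) (k ` u ` x)))"

lemma moves_maximallyE: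
  assumes "moves_maximally k" "finite X" "finite x"
  obtains u where "u \<in> Fix X" "indep (u ` x) X (k ` X \<union> k ` u ` x)"
    "indep (X \<union> u ` x) (k ` X) (k ` u ` x)"
  using assms unfolding moves_maximally_def by blast

text \<open>The step from almost maximal to maximal comes from placing the new point freely over
  a large set \<open>Z\<close> before using the hypothesis over \<open>Z\<close>: then the point and its image are
  independent over \<open>Z\<close>, and transitivity pushes this down to the small base. The set \<open>Z\<close> contains
  images and preimages under \<^term>\<open>k\<close>, so that the freeness of the point can also be transported
  by \<^term>\<open>k\<close> to its image. Adding points one at a time treats finite sets in the same way.\<close>

lemma moves_maximallyI:
  assumes k: "k \<in> G" and am: "moves_almost_maximally M cl ind k"
  shows "moves_maximally k"
  unfolding moves_maximally_def
proof (intro allI impI)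
  fix X x :: "'a set"
  assume X: "finite X" and "finite x"
  from this(2)
  show "\<exists>u\<in>Fix X. indep (u ` x) X (k ` X \<union> k ` u ` x) \<and> indep (X \<union> u ` x) (k ` X) (k ` u ` x)"
  proof induction
    case empty
    have "id \<in> Fix X" by (simp add: fixator_def Aut_id)
    moreover have "indep {} X (k ` X)"
      using indep_mono[OF indep_sym[OF indep_over_self[of "k ` X" X]], of "{}" "k ` X"] X by simp
    moreover have "indep X (k ` X) {}"
      using indep_mono[OF indep_over_self[of X "k ` X"], of X "{}"] X by simp
    ultimately show ?case by (intro bexI[of _ id]) auto
  next
    case (insert b a)
    then obtain u where u: "u \<in> Fix X"
      and ind1: "indep (u ` a) X (k ` X \<union> k ` u ` a)"
      and ind2: "indep (X \<union> u ` a) (k ` X) (k ` u ` a)"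
      by blast
    define a' where "a' = u ` a"
    define Z where "Z = X \<union> a' \<union> k ` X \<union> k ` a' \<union> inv k ` X \<union> inv k ` a'"
    have fin: "finite a'" "finite Z" using X insert.hyps by (auto simp: a'_def Z_def)
    obtain v where v: "v \<in> Fix (X \<union> a')" "indep (v ` {u b}) (X \<union> a') Z"
      using indep_exists[of "{u b}" "X \<union> a'" Z] X fin by blast
    obtain w where w: "w \<in> Fix Z" "ind {w (v (u b))} (cl Z) {k (w (v (u b)))}"
    proof -
      have "cl Z \<in> fin_closures cl" using fin by (auto simp: fin_closures_def)
      with am[unfolded moves_almost_maximally_def]
      obtain e where "e \<in> {h (v (u b)) | h. h \<in> fixator M (cl Z)}" "ind {e} (cl Z) {k e}"
        by blast
      then show ?thesis using that by blast
    qed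
    define b' where "b' = w (v (u b))"
    have wZ: "w ` Y = Y" if "Y \<subseteq> Z" for Y
      using Fix_image[OF w(1)] cl_ext[of Z] that by blast
    have over_Z: "indep {b'} Z {k b'}"
      using w(2) ind_compat_base fin indep_args_finite by (simp add: indep_def b'_def)
    have "indep (w ` v ` {u b}) (w ` (X \<union> a')) (w ` Z)"
      using v(2) w(1) indep_image FixD by blast
    moreover have "w ` (X \<union> a') = X \<union> a'" by (rule wZ) (auto simp: Z_def)
    moreover have "w ` Z = Z" by (rule wZ) simp
    ultimately have bZ: "indep {b'} (X \<union> a') Z"
      by (simp only: b'_def image_insert image_empty)
    \<comment> \<open>freeness of the new point over everything relevant, including its own image\<close>
    have b: "indep {b'} (X \<union> a') (Z \<union> {k b'})"
      by (rule indep_trans[OF bZ over_Z]) (auto simp: Z_def)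
    \<comment> \<open>freeness of the image, obtained by applying \<^term>\<open>k\<close>\<close>
    have "indep (k ` {b'}) (k ` (X \<union> a')) (k ` Z)" using bZ k by (rule indep_image)
    moreover have "X \<union> a' \<subseteq> k ` Z"
      using k by (auto simp: Z_def image_Un)
    ultimately have kb: "indep {k b'} (k ` X \<union> k ` a') (X \<union> a')"
      using indep_mono[of "{k b'}" "k ` X \<union> k ` a'" "k ` Z" "{k b'}" "X \<union> a'"]
      by (simp add: image_Un) blast
    have 1: "indep (insert b' a') X (k ` X \<union> k ` insert b' a')"
    proof -
      have "indep a' (k ` X \<union> k ` a' \<union> X) {k b'}"
        by (rule indep_sym, rule indep_base[OF kb]) auto
      then have "indep a' X (k ` X \<union> k ` a' \<union> {k b'})"
        by (rule indep_trans[OF ind1[folded a'_def]]) auto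
      moreover have "indep {b'} (X \<union> a') (k ` X \<union> k ` a' \<union> {k b'})"
        by (rule indep_mono[OF b]) (auto simp: Z_def)
      ultimately have "indep ({b'} \<union> a') X (k ` X \<union> k ` a' \<union> {k b'})"
        by (rule indep_trans_left) auto
      then show ?thesis by (simp add: insert_commute)
    qed
    have 2: "indep (X \<union> insert b' a') (k ` X) (k ` insert b' a')"
    proof -
      have "indep (X \<union> a') (k ` X \<union> k ` a') {k b'}" using kb by (rule indep_sym)
      then have A: "indep (X \<union> a') (k ` X) (k ` insert b' a')"
        by (rule indep_trans[OF ind2[folded a'_def]]) auto
      have B: "indep {b'} (X \<union> a' \<union> k ` X) (k ` insert b' a')"
        by (rule indep_base[OF b]) (auto simp: Z_def)
      show ?thesis
        by (rule indep_trans_left[OF A B]) auto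
    qed
    let ?t = "w \<circ> v \<circ> u"
    have "v \<in> Fix X" using v(1) by (rule Fix_mono) (use cl_ext[of "X \<union> a'"] in blast)
    moreover have "w \<in> Fix X" using w(1) by (rule Fix_mono) (use cl_ext[of Z] in \<open>auto simp: Z_def\<close>)
    ultimately have "?t \<in> Fix X" using u by (intro Fix_comp)
    moreover have "v ` a' = a'" using Fix_image[OF v(1)] cl_ext[of "X \<union> a'"] by blast
    then have "w ` v ` u ` a = a'" using wZ[of a'] by (simp add: Z_def le_supI1 flip: a'_def)
    then have "?t ` a = a'" by (simp only: image_comp comp_assoc)
    then have "?t ` insert b a = insert b' a'" by (simp only: image_insert b'_def comp_apply)
    ultimately show ?case using 1 2 by (intro bexI[of _ ?t]) simp_all
  qed
qed

lemma moves_maximally_inv: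
  assumes k: "k \<in> G" and max: "moves_maximally k"
  shows "moves_maximally (inv k)"
  unfolding moves_maximally_def
proof (intro allI impI)
  fix X x :: "'a set"
  assume "finite X" "finite x"
  then obtain u where u: "u \<in> Fix (inv k ` X)"
    and 1: "indep (u ` inv k ` x) (inv k ` X) (k ` inv k ` X \<union> k ` u ` inv k ` x)"
    and 2: "indep (inv k ` X \<union> u ` inv k ` x) (k ` inv k ` X) (k ` u ` inv k ` x)"
    using moves_maximallyE[OF max, of "inv k ` X" "inv k ` x"] by blast
  let ?u = "k \<circ> u \<circ> inv k"
  have "?u z = z" if "z \<in> cl X" for z
  proof -
    have "inv k z \<in> cl (inv k ` X)" using k that by (intro cl_imageI[of "inv k"]) (auto intro: Aut_inv)
    then show ?thesis using Fix_apply[OF u] k by simp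
  qed
  then have "?u \<in> Fix X"
    using k FixD[OF u] by (simp add: fixator_def Aut_comp Aut_inv)
  moreover have "?u ` x = k ` u ` inv k ` x" by (simp add: image_comp)
  moreover note indep_sym[OF 1] indep_sym[OF 2]
  ultimately show "\<exists>u\<in>Fix X. indep (u ` x) X (inv k ` X \<union> inv k ` u ` x) \<and>
      indep (X \<union> u ` x) (inv k ` X) (inv k ` u ` x)"
    using k by (intro bexI[of _ ?u]) simp_all
qed

definition conj_by :: "('a \<Rightarrow> 'a) \<Rightarrow> ('a \<Rightarrow> 'a) \<Rightarrow> 'a \<Rightarrow> 'a" where
  "conj_by a k = inv a \<circ> k \<circ> a"

lemma conj_by_Aut: "a \<in> G \<Longrightarrow> k \<in> G \<Longrightarrow> conj_by a k \<in> G"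
  by (simp add: conj_by_def Aut_comp Aut_inv)

lemma conj_by_comp:
  assumes "a \<in> G" "b \<in> G"
  shows "conj_by (b \<circ> a) k = conj_by a (conj_by b k)"
  using assms by (simp add: conj_by_def o_inv_distrib Aut_bij comp_assoc)

lemma conj_by_inv:
  assumes "a \<in> G" "k \<in> G"
  shows "conj_by a (inv k) = inv (conj_by a k)"
  using assms
  by (simp add: conj_by_def o_inv_distrib bij_comp bij_imp_bij_inv inv_inv_eq Aut_bij comp_assoc)

text \<open>The reason for taking conjugators from \<open>Fix (X \<union> k ` X)\<close>: they fix both the arguments in
  \<^term>\<open>cl X\<close> and their values, so what is already known about \<^term>\<open>k\<close> survives.\<close>

lemma conj_by_Fix:
  assumes a: "a \<in> Fix (X \<union> k ` X)" and k: "k \<in> G" and z: "z \<in> cl X"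
  shows "conj_by a k z = k z"
proof -
  have "a z = z" using Fix_apply[OF a] z cl_mono[of X "X \<union> k ` X"] by blast
  moreover have "k z \<in> cl (X \<union> k ` X)" using k z by (rule cl_imageI) auto
  ultimately show ?thesis using Fix_apply[OF Fix_inv[OF a]] by (simp add: conj_by_def)
qed

lemma moves_maximally_conj:
  assumes k: "k \<in> G" and max: "moves_maximally k" and a: "a \<in> G"
  shows "moves_maximally (conj_by a k)"
  unfolding moves_maximally_def
proof (intro allI impI)
  fix X x :: "'a set"
  assume "finite X" "finite x"
  then obtain u where u: "u \<in> Fix (a ` X)"
    and 1: "indep (u ` a ` x) (a ` X) (k ` a ` X \<union> k ` u ` a ` x)"
    and 2: "indep (a ` X \<union> u ` a ` x) (k ` a ` X) (k ` u ` a ` x)"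
    using moves_maximallyE[OF max, of "a ` X" "a ` x"] by blast
  let ?u = "inv a \<circ> u \<circ> a"
  have "?u z = z" if "z \<in> cl X" for z
  proof -
    have "a z \<in> cl (a ` X)" using a that by (intro cl_imageI[of a]) auto
    then show ?thesis using Fix_apply[OF u] a by simp
  qed
  then have "?u \<in> Fix X"
    using a FixD[OF u] by (simp add: fixator_def Aut_comp Aut_inv)
  moreover have "?u ` x = inv a ` u ` a ` x" by (simp add: image_comp)
  moreover have "conj_by a k ` Y = inv a ` k ` a ` Y" for Y
    by (simp add: conj_by_def image_comp)
  moreover note indep_image[OF 1 Aut_inv[OF a]] indep_image[OF 2 Aut_inv[OF a]]
  ultimately show "\<exists>u\<in>Fix X. indep (u ` x) X (conj_by a k ` X \<union> conj_by a k ` u ` x) \<and>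
      indep (X \<union> u ` x) (conj_by a k ` X) (conj_by a k ` u ` x)"
    using a by (intro bexI[of _ ?u]) (simp_all add: image_Un)
qed

text \<open>Up to \<open>Fix X\<close>, the automorphism \<^term>\<open>k\<close> moves \<^term>\<open>x\<close> maximally, say as a copy
  \<open>u ` x\<close>. The pairs \<open>(x, w ` x)\<close> and \<open>(u ` x, k ` u ` x)\<close> then satisfy the same independences, so two
  uses of stationarity, one for each component, yield an automorphism over \<open>X \<union> k ` X\<close> carrying
  the first pair to the second. It conjugates \<^term>\<open>k\<close> to a map that agrees with \<^term>\<open>w\<close> on
  \<^term>\<open>x\<close>.\<close>

lemma conjugate_prescribed:
  assumes k: "k \<in> G" and max: "moves_maximally k" and w: "w \<in> G"
    and agree: "\<And>z. z \<in> cl X \<Longrightarrow> w z = k z"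
    and ind1: "indep x X (k ` X \<union> w ` x)" and ind2: "indep (X \<union> x) (k ` X) (w ` x)"
  shows "\<exists>a\<in>Fix (X \<union> k ` X). \<forall>z\<in>cl (X \<union> x). conj_by a k z = w z"
proof -
  have fin: "finite X" "finite x" using ind2 by (simp_all add: indep_def)
  obtain u where u: "u \<in> Fix X" and uind1: "indep (u ` x) X (k ` X \<union> k ` u ` x)"
    and uind2: "indep (X \<union> u ` x) (k ` X) (k ` u ` x)"
    using moves_maximallyE[OF max fin] .
  have uX: "u ` X = X" using Fix_image[OF u cl_ext] .
  \<comment> \<open>first component: \<^term>\<open>v\<close> carries \<^term>\<open>x\<close> to \<open>u ` x\<close> over \<open>X \<union> k ` X\<close>\<close>
  obtain v where v: "v \<in> Fix (X \<union> k ` X)" and vu: "\<forall>z\<in>cl (x \<union> X). v z = u z"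
    using indep_stationary[OF indep_mono[OF ind1] indep_mono[OF uind1] u, of x "k ` X"] by auto
  have vX: "v ` (k ` X) = k ` X" "v ` X = X"
    using Fix_image[OF v] cl_ext[of "X \<union> k ` X"] by auto
  have vx: "v ` x = u ` x"
    using vu cl_ext[of "x \<union> X"] by (intro image_cong) auto
  have vFix: "v \<in> Fix (k ` X)" using v by (rule Fix_mono) (use cl_ext[of "X \<union> k ` X"] in auto)
  \<comment> \<open>second component: \<^term>\<open>s\<close> witnesses that \<open>w ` x\<close> and \<open>k ` u ` x\<close> have the same type over \<open>k ` X\<close>\<close>
  define s where "s = k \<circ> u \<circ> inv w"
  have "s z = z" if "z \<in> cl (k ` X)" for z
  proof -
    have "z \<in> k ` cl X" using that by (simp only: cl_image[OF k])
    then obtain z' where z': "z = k z'" "z' \<in> cl X" by (rule imageE)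
    then have "inv w z = z'" using agree[of z'] Aut_inv_apply(1)[OF w, of z'] by simp
    then show ?thesis using z' Fix_apply[OF u] by (simp add: s_def)
  qed
  then have s: "s \<in> Fix (k ` X)"
    using k w FixD[OF u] by (simp add: s_def fixator_def Aut_comp Aut_inv)
  have sw: "s (w z) = k (u z)" for z using w by (simp add: s_def)
  define r where "r = s \<circ> inv v"
  have r: "r \<in> Fix (k ` X)" unfolding r_def using s Fix_inv[OF vFix] by (rule Fix_comp)
  have rv: "r (v z) = s z" for z using FixD[OF v] by (simp add: r_def)
  have "indep (v ` w ` x) (v ` k ` X) (v ` (X \<union> x))"
    using indep_image[OF indep_sym[OF ind2] FixD[OF v]] .
  then have y: "indep (v ` w ` x) (k ` X) (X \<union> u ` x)"
    by (simp add: vX vx image_Un)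
  have "r ` v ` w ` x = k ` u ` x"
    by (simp add: image_image rv sw)
  then have ry: "indep (r ` v ` w ` x) (k ` X) (X \<union> u ` x)"
    using indep_sym[OF uind2] by simp
  obtain q where q: "q \<in> Fix (k ` X \<union> (X \<union> u ` x))"
    and qr: "\<forall>z\<in>cl (v ` w ` x \<union> k ` X). q z = r z"
    using indep_stationary[OF y ry r] by blast
  let ?a = "q \<circ> v"
  have qX: "q \<in> Fix (X \<union> k ` X)"
    using q by (rule Fix_mono) (use cl_ext[of "k ` X \<union> (X \<union> u ` x)"] in auto)
  have a: "?a \<in> Fix (X \<union> k ` X)" using qX v by (rule Fix_comp)
  have "conj_by ?a k z = w z" if z: "z \<in> cl (X \<union> x)" for z
  proof -
    have "u z \<in> cl (k ` X \<union> (X \<union> u ` x))"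
      using FixD[OF u] z by (rule cl_imageI) (auto simp: image_Un uX)
    then have 1: "?a z = u z"
      using vu z Fix_apply[OF q] by (simp add: Un_commute)
    have "w ` X = k ` X"
      using agree cl_ext[of X] by (intro image_cong) auto
    then have "(v \<circ> w) ` (X \<union> x) = k ` X \<union> v ` w ` x"
      using vX(1) by (simp only: image_Un flip: image_comp)
    then have "(v \<circ> w) z \<in> cl (v ` w ` x \<union> k ` X)"
      using cl_imageI[OF Aut_comp[OF FixD[OF v] w] z] by simp
    then have "?a (w z) = k (u z)"
      using qr rv sw by simp
    then have "k (?a z) = ?a (w z)" using 1 by simp
    then show ?thesis
      using Aut_inv_apply(1)[OF FixD[OF a]] by (simp add: conj_by_def)
  qed
  then show ?thesis using a by blast
qed

text \<open>A given set \<^term>\<open>x\<close>, whatever its position with respect to \<^term>\<open>Y\<close>, can be sent to a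
  set independent from \<^term>\<open>Y\<close>. Moving \<^term>\<open>x\<close> maximally over \<open>X \<union> k ` X\<close> makes its image
  \<open>y\<close> under a first conjugate of \<^term>\<open>k\<close> independent from \<^term>\<open>x\<close> over this base. Hence \<open>y\<close> may be replaced by a copy that is also
  independent from \<^term>\<open>Y\<close>, without changing the type of the pair; the hypothesis on
  \<^term>\<open>X\<close> then lowers the base to \<open>k ` X\<close>.\<close>

lemma conjugate_independent:
  assumes k: "k \<in> G" and max: "moves_maximally k"
    and ind: "indep X (k ` X) Y" and x: "finite x"
  shows "\<exists>a\<in>Fix (X \<union> k ` X). indep (conj_by a k ` x) (k ` X) Y"
proof -
  let ?B = "X \<union> k ` X"
  have fin: "finite ?B" "finite Y" using ind by (simp_all add: indep_def)
  obtain u where u: "u \<in> Fix ?B" and uind: "indep (u ` x) ?B (k ` ?B \<union> k ` u ` x)"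
    using moves_maximallyE[OF max fin(1) x] .
  have uG: "u \<in> G" using FixD[OF u] .
  define y where "y = inv u ` k ` u ` x"
  have "indep (u ` x) ?B (k ` u ` x)" by (rule indep_mono[OF uind]) auto
  then have "indep (inv u ` u ` x) (inv u ` ?B) (inv u ` k ` u ` x)"
    using Aut_inv[OF uG] by (rule indep_image)
  moreover have "inv u ` ?B = ?B" using Fix_image[OF Fix_inv[OF u] cl_ext] .
  ultimately have xy: "indep x ?B y" using uG by (simp add: y_def)
  have "finite y" using x by (simp add: y_def)
  then obtain e where e: "e \<in> Fix ?B" "indep (e ` y) ?B (x \<union> Y)"
    using indep_exists[of y ?B "x \<union> Y"] x fin by blast
  have "indep (e ` y) ?B x" by (rule indep_mono[OF e(2)]) auto
  then obtain v where v: "v \<in> Fix (?B \<union> x)" and ve: "\<forall>z\<in>cl (y \<union> ?B). v z = e z"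
    using indep_stationary[OF indep_sym[OF xy] _ e(1)] by blast
  have vG: "v \<in> G" using FixD[OF v] .
  have vB: "v \<in> Fix ?B" using v by (rule Fix_mono) (use cl_ext[of "?B \<union> x"] in auto)
  let ?a = "u \<circ> inv v"
  have a: "?a \<in> Fix ?B" using u Fix_inv[OF vB] by (rule Fix_comp)
  have invx: "inv v ` x = x"
    using Fix_image[OF Fix_inv[OF v]] cl_ext[of "?B \<union> x"] by auto
  have "conj_by ?a k = v \<circ> inv u \<circ> k \<circ> u \<circ> inv v"
    using uG vG by (simp add: conj_by_def o_inv_distrib Aut_bij bij_imp_bij_inv inv_inv_eq comp_assoc)
  then have "conj_by ?a k ` x = v ` inv u ` k ` u ` inv v ` x" by (simp only: image_comp comp_assoc)
  then have "conj_by ?a k ` x = v ` y" by (simp only: invx y_def)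
  also have "\<dots> = e ` y"
    using ve cl_ext[of "y \<union> ?B"] by (intro image_cong) auto
  finally have conj: "conj_by ?a k ` x = e ` y" .
  have "indep (conj_by ?a k ` x) ?B Y"
    unfolding conj by (rule indep_mono[OF e(2)]) auto
  then have "indep (conj_by ?a k ` x) (k ` X) Y"
    by (rule indep_trans_left[OF ind]) auto
  then show ?thesis using a by blast
qed

lemma conjugate_inv_independent:
  assumes k: "k \<in> G" and max: "moves_maximally k"
    and ind: "indep Y X (k ` X)" and x: "finite x"
  shows "\<exists>a\<in>Fix (X \<union> k ` X). indep (inv (conj_by a k) ` x) X Y"
proof -
  have "inv k ` k ` X = X" using k by simp
  then obtain a where "a \<in> Fix (k ` X \<union> X)" "indep (conj_by a (inv k) ` x) X Y"
    using conjugate_independent[OF Aut_inv[OF k] moves_maximally_inv[OF k max], of "k ` X" Y x]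
      indep_sym[OF ind] x by auto
  then show ?thesis using conj_by_inv[OF _ k] FixD by (auto simp: Un_commute)
qed

text \<open>The outer conjugates are changed first: they send \<^term>\<open>x\<close> forward to \<open>x1\<close> and \<open>w ` x\<close>
  backward to \<open>x3\<close>, both independent from the middle set \<^term>\<open>X2\<close>. What remains is to factor
  the induced map from \<open>x1\<close> to \<open>x3\<close> through two conjugates. Any copy \<open>x2\<close> of the right type over
  \<^term>\<open>X2\<close> that is independent from everything else can serve as the intermediate image, because
  the values on both sides are then independent in the way \<open>conjugate_prescribed\<close> demands.\<close>

lemma four_conjugates:
  assumes k: "k0 \<in> G" "k1 \<in> G" "k2 \<in> G" "k3 \<in> G"
    and max: "moves_maximally k0" "moves_maximally k1" "moves_maximally k2" "moves_maximally k3"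
    and X: "X1 = k0 ` X0" "X2 = k1 ` X1" "X3 = k2 ` X2" "X4 = k3 ` X3"
    and ind1: "indep X0 X1 X2" and ind2: "indep X2 X3 X4"
    and w: "w \<in> G" and agree: "\<And>z. z \<in> cl X0 \<Longrightarrow> w z = k3 (k2 (k1 (k0 z)))"
    and x: "finite x"
  shows "\<exists>a0\<in>Fix (X0 \<union> X1). \<exists>a1\<in>Fix (X1 \<union> X2). \<exists>a2\<in>Fix (X2 \<union> X3). \<exists>a3\<in>Fix (X3 \<union> X4).
    \<forall>z\<in>cl (X0 \<union> x). w z = conj_by a3 k3 (conj_by a2 k2 (conj_by a1 k1 (conj_by a0 k0 z)))"
proof -
  obtain a0 where a0: "a0 \<in> Fix (X0 \<union> X1)" and b0: "indep (conj_by a0 k0 ` x) X1 X2"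
    using conjugate_independent[OF k(1) max(1) ind1[unfolded X(1)] x] X(1) by blast
  obtain a3 where a3: "a3 \<in> Fix (X3 \<union> X4)" and b3: "indep (inv (conj_by a3 k3) ` w ` x) X3 X2"
    using conjugate_inv_independent[OF k(4) max(4) ind2[unfolded X(4)], of "w ` x"] x X(4) by blast
  define l0 where "l0 = conj_by a0 k0"
  define l3 where "l3 = conj_by a3 k3"
  have l: "l0 \<in> G" "l3 \<in> G" using k a0 a3 FixD conj_by_Aut by (auto simp: l0_def l3_def)
  have l0: "l0 z = k0 z" if "z \<in> cl X0" for z
    using conj_by_Fix[OF a0[unfolded X(1)] k(1) that] by (simp add: l0_def)
  have l3: "l3 z = k3 z" if "z \<in> cl X3" for z
    using conj_by_Fix[OF a3[unfolded X(4)] k(4) that] by (simp add: l3_def)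
  define x1 where "x1 = l0 ` x"
  define x3 where "x3 = inv l3 ` w ` x"
  have x1: "indep x1 X1 X2" using b0 by (simp add: x1_def l0_def)
  have x3: "indep x3 X3 X2" using b3 by (simp add: x3_def l3_def)
  have fin: "finite X1" "finite X2" "finite X3" "finite x1" "finite x3"
    using x1 x3 by (simp_all add: indep_def)
  obtain e where e: "e \<in> Fix X2" "indep (e ` k1 ` x1) X2 (X1 \<union> x1 \<union> X3 \<union> x3)"
    using indep_exists[of "k1 ` x1" X2 "X1 \<union> x1 \<union> X3 \<union> x3"] fin by blast
  define x2 where "x2 = e ` k1 ` x1"
  have x2: "indep x2 X2 (X1 \<union> x1 \<union> X3 \<union> x3)" using e(2) by (simp add: x2_def)
  \<comment> \<open>the intermediate set \<^term>\<open>x2\<close> determines the two factors that have to be realised\<close>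
  define w1 where "w1 = e \<circ> k1"
  let ?w2 = "inv l3 \<circ> w \<circ> inv l0 \<circ> inv w1"
  have w1: "w1 \<in> G" using k FixD[OF e(1)] by (simp add: w1_def Aut_comp)
  have w2: "?w2 \<in> G" using l w w1 by (simp add: Aut_comp Aut_inv)
  have w1k: "w1 z = k1 z" if "z \<in> cl X1" for z
    using Fix_apply[OF e(1)] cl_imageI[OF k(2) that, of X2] X(2) by (simp add: w1_def)
  have w1x: "w1 ` x1 = x2" by (simp add: x2_def w1_def image_comp)
  have w2x: "?w2 ` x2 = x3"
    unfolding w1x[symmetric] x1_def x3_def using l w1
    by (simp add: image_image)
  have w2k: "?w2 z = k2 z" if z: "z \<in> cl X2" for z
  proof -
    obtain y where y: "z = k1 (k0 y)" "y \<in> cl X0"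
    proof -
      have "z \<in> k1 ` k0 ` cl X0" using z by (simp add: X cl_image k)
      then show ?thesis using that by blast
    qed
    have k0y: "k0 y \<in> cl X1" using cl_imageI[OF k(1) y(2)] X(1) by simp
    have "z = w1 (l0 y)" using w1k[OF k0y] y l0 by simp
    then have "?w2 z = inv l3 (w y)" 
      using Aut_inv_apply(1)[OF w1] Aut_inv_apply(1)[OF l(1)] by simp
    also have "w y = k3 (k2 z)" using agree[OF y(2)] y(1) by simp
    also have "\<dots> = l3 (k2 z)" using l3 cl_imageI[OF k(3) z, of X3] X(3) by simp
    finally show ?thesis using l by simp
  qed
  obtain a1 where a1: "a1 \<in> Fix (X1 \<union> X2)" and c1: "\<forall>z\<in>cl (X1 \<union> x1). conj_by a1 k1 z = w1 z"
  proof -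
    have x21: "indep x1 (X1 \<union> X2) x2"
      by (rule indep_sym, rule indep_base[OF x2]) auto
    have "indep x1 X1 (X2 \<union> x2)" by (rule indep_trans[OF x1 x21]) auto
    moreover have "indep (X1 \<union> x1) X2 x2"
      using indep_sym[OF indep_mono[OF x2, of x2 "X1 \<union> x1"]] by auto
    ultimately show ?thesis
      using conjugate_prescribed[OF k(2) max(2) w1, of X1 x1] w1k w1x X(2) that by auto
  qed
  obtain a2 where a2: "a2 \<in> Fix (X2 \<union> X3)" and c2: "\<forall>z\<in>cl (X2 \<union> x2). conj_by a2 k2 z = ?w2 z"
  proof -
    have "indep x2 X2 (X3 \<union> x3)" by (rule indep_mono[OF x2]) auto
    moreover have "indep x3 (X3 \<union> X2) x2"
      by (rule indep_sym, rule indep_base[OF x2]) auto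
    then have "indep x3 X3 (X2 \<union> x2)" by (rule indep_trans[OF x3]) auto
    then have "indep (X2 \<union> x2) X3 x3" by (rule indep_sym)
    ultimately show ?thesis
      using conjugate_prescribed[OF k(3) max(3) w2, of X2 x2] w2k w2x X(3) that by auto
  qed
  have "w z = conj_by a3 k3 (conj_by a2 k2 (conj_by a1 k1 (conj_by a0 k0 z)))"
    if z: "z \<in> cl (X0 \<union> x)" for z
  proof -
    have "l0 ` X0 = k0 ` X0" using l0 cl_ext[of X0] by (intro image_cong) auto
    then have z1: "l0 z \<in> cl (X1 \<union> x1)"
      using l(1) z by (intro cl_imageI[of l0]) (auto simp: image_Un x1_def X(1))
    have "w1 ` X1 = k1 ` X1" using w1k cl_ext[of X1] by (intro image_cong) auto
    then have "w1 ` (X1 \<union> x1) = X2 \<union> x2" by (simp only: image_Un w1x X(2))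
    then have z2: "w1 (l0 z) \<in> cl (X2 \<union> x2)"
      using cl_imageI[OF w1 z1, of "X2 \<union> x2"] by simp
    have "?w2 (w1 (l0 z)) = inv l3 (w z)"
      using Aut_inv_apply(1)[OF w1] Aut_inv_apply(1)[OF l(1)] by simp
    then have "l3 (conj_by a2 k2 (conj_by a1 k1 (l0 z))) = w z"
      using z1 z2 c1 c2 l by simp
    then show ?thesis by (simp add: l0_def l3_def)
  qed
  then show ?thesis using a0 a1 a2 a3 by blast
qed

end

section \<open>Products of four conjugates\<close>

locale maximal_mover = independent_structure M cl ind
  for M :: "('a, 'f, 'r) fo_structure" and cl ind +
  fixes g :: "'a \<Rightarrow> 'a"
  assumes g_Aut: "g \<in> Aut M"
    and g_max: "moves_maximally g"
begin

text \<open>A chain is given by conjugators \<open>b 0, b 1, \<dots>\<close> and a finite starting set \<open>D\<close>; the sets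
  \<open>walk b i ` D\<close> are the successive images under the conjugates \<open>conj_by (b i) g\<close>. Recording the
  conjugators rather than the conjugates matters in the limit: the conjugators have to converge
  for the limit maps to be conjugates of \<^term>\<open>g\<close>.\<close>

primrec walk :: "(nat \<Rightarrow> 'a \<Rightarrow> 'a) \<Rightarrow> nat \<Rightarrow> 'a \<Rightarrow> 'a" where
  "walk b 0 = id"
| "walk b (Suc i) = conj_by (b i) g \<circ> walk b i"

text \<open>Refinement of chains of length four. Since the old and new conjugators agree on two
  consecutive sets of the chain, the conjugates agree on the first of them, so the known part of
  the walk is unchanged. In topological terms \<^term>\<open>(b, D)\<close> stands for a basic open set of
  fourfold conjugators.\<close>

definition refines :: "(nat \<Rightarrow> 'a \<Rightarrow> 'a) \<Rightarrow> 'a set \<Rightarrow> (nat \<Rightarrow> 'a \<Rightarrow> 'a) \<Rightarrow> 'a set \<Rightarrow> bool" where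
  "refines b D b' D' \<longleftrightarrow> D \<subseteq> D' \<and>
     (\<forall>i<4. \<forall>x\<in>cl (walk b i ` D \<union> walk b (Suc i) ` D). b' i x = b i x)"

lemma conj_g_Aut: "range b \<subseteq> G \<Longrightarrow> conj_by (b i) g \<in> G"
  using conj_by_Aut g_Aut by blast

lemma walk_Aut: "range b \<subseteq> G \<Longrightarrow> walk b i \<in> G"
  by (induction i) (simp_all add: Aut_id Aut_comp conj_g_Aut)

lemma walk_cl: "range b \<subseteq> G \<Longrightarrow> x \<in> cl D \<Longrightarrow> walk b i x \<in> cl (walk b i ` D)"
  using cl_imageI[OF walk_Aut] by blast

lemma refines_walk:
  assumes b: "range b \<subseteq> G" and b': "range b' \<subseteq> G" and ref: "refines b D b' D'"
    and x: "x \<in> cl D" and "i \<le> 4"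
  shows "walk b' i x = walk b i x"
  using assms(5)
proof (induction i)
  case (Suc i)
  let ?y = "walk b i x" and ?z = "walk b (Suc i) x"
  let ?E = "cl (walk b i ` D \<union> walk b (Suc i) ` D)"
  have "?y \<in> ?E"
    using walk_cl[OF b x, of i] cl_mono[of "walk b i ` D" "walk b i ` D \<union> walk b (Suc i) ` D"] by auto
  moreover have "?z \<in> ?E"
    using walk_cl[OF b x, of "Suc i"]
      cl_mono[of "walk b (Suc i) ` D" "walk b i ` D \<union> walk b (Suc i) ` D"] by auto
  moreover have agree: "\<forall>v\<in>?E. b' i v = b i v" using ref Suc.prems by (simp add: refines_def)
  ultimately have y: "b' i ?y = b i ?y" and z: "b' i ?z = b i ?z" by blast+
  have Ab: "b i \<in> G" "b' i \<in> G" using b b' by auto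
  have "b i ?z = g (b i ?y)" using Aut_inv_apply(2)[OF Ab(1)] by (simp add: conj_by_def)
  then have "b' i ?z = g (b' i ?y)" by (simp only: y z)
  then have "?z = conj_by (b' i) g ?y"
    using Aut_inv_apply(1)[OF Ab(2), of ?z] by (simp add: conj_by_def)
  moreover have "walk b' i x = ?y" using Suc.IH Suc.prems by simp
  ultimately show ?case by simp
qed simp

lemma refines_walk_image:
  assumes "range b \<subseteq> G" "range b' \<subseteq> G" "refines b D b' D'" "i \<le> 4"
  shows "walk b' i ` D = walk b i ` D"
  using refines_walk[OF assms(1-3) _ assms(4)] cl_ext[of D] by (intro image_cong) auto

lemma refines_walk_subset:
  assumes "range b \<subseteq> G" "range b' \<subseteq> G" "refines b D b' D'" "i \<le> 4"
  shows "walk b i ` D \<subseteq> walk b' i ` D'"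
proof -
  have "D \<subseteq> D'" using assms(3) by (simp add: refines_def)
  then show ?thesis using refines_walk_image[OF assms] by blast
qed

lemma refines_closure_subset:
  assumes "range b \<subseteq> G" "range b' \<subseteq> G" "refines b D b' D'" "i < 4"
  shows "cl (walk b i ` D \<union> walk b (Suc i) ` D) \<subseteq> cl (walk b' i ` D' \<union> walk b' (Suc i) ` D')"
  using refines_walk_subset[OF assms(1-3), of i] refines_walk_subset[OF assms(1-3), of "Suc i"] assms(4)
  by (intro cl_mono Un_mono) auto

lemma refines_trans:
  assumes "range b \<subseteq> G" "range b' \<subseteq> G" "refines b D b' D'" "refines b' D' b'' D''"
  shows "refines b D b'' D''"
  unfolding refines_def
proof (intro conjI allI impI ballI)
  show "D \<subseteq> D''" using assms(3,4) by (auto simp: refines_def)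
next
  fix i :: nat and x
  assume i: "i < 4" and x: "x \<in> cl (walk b i ` D \<union> walk b (Suc i) ` D)"
  have "b' i x = b i x" using assms(3) i x by (simp add: refines_def)
  moreover have "x \<in> cl (walk b' i ` D' \<union> walk b' (Suc i) ` D')"
    using refines_closure_subset[OF assms(1-3) i] x by blast
  then have "b'' i x = b' i x" using assms(4) i by (simp add: refines_def)
  ultimately show "b'' i x = b i x" by simp
qed

lemma refines_same: "D \<subseteq> D' \<Longrightarrow> refines b D b D'"
  by (simp add: refines_def)

text \<open>Precisely the two independences under which \<open>four_conjugates\<close> lets the product of the
  chain be prescribed.\<close>

definition good :: "(nat \<Rightarrow> 'a \<Rightarrow> 'a) \<Rightarrow> 'a set \<Rightarrow> bool" where
  "good b D \<longleftrightarrow> indep (walk b 0 ` D) (walk b 1 ` D) (walk b 2 ` D) \<and>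
     indep (walk b 2 ` D) (walk b 3 ` D) (walk b 4 ` D)"

lemma good_finite: "good b D \<Longrightarrow> finite D"
  by (simp add: good_def indep_def)

lemma walk_4: "walk b 4 x = conj_by (b 3) g (conj_by (b 2) g (conj_by (b 1) g (conj_by (b 0) g x)))"
  by (simp add: eval_nat_numeral)

lemma walk_images:
  "walk b 1 ` D = conj_by (b 0) g ` walk b 0 ` D"
  "walk b 2 ` D = conj_by (b 1) g ` walk b 1 ` D"
  "walk b 3 ` D = conj_by (b 2) g ` walk b 2 ` D"
  "walk b 4 ` D = conj_by (b 3) g ` walk b 3 ` D"
  by (simp_all add: eval_nat_numeral image_image)

lemma good_extend:
  assumes b: "range b \<subseteq> G" and good: "good b D" and F: "D \<subseteq> F" "finite F"
    and w: "w \<in> G" and agree: "\<And>x. x \<in> cl D \<Longrightarrow> w x = walk b 4 x"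
  shows "\<exists>b'. range b' \<subseteq> G \<and> refines b D b' F \<and> (\<forall>x\<in>cl F. walk b' 4 x = w x)"
proof -
  have k: "conj_by (b i) g \<in> G" "moves_maximally (conj_by (b i) g)" for i
    using b conj_g_Aut moves_maximally_conj[OF g_Aut g_max] by auto
  note gd = good[unfolded good_def]
  obtain a0 a1 a2 a3 where
    a: "a0 \<in> Fix (walk b 0 ` D \<union> walk b 1 ` D)" "a1 \<in> Fix (walk b 1 ` D \<union> walk b 2 ` D)"
      "a2 \<in> Fix (walk b 2 ` D \<union> walk b 3 ` D)" "a3 \<in> Fix (walk b 3 ` D \<union> walk b 4 ` D)"
    and eq: "\<forall>z\<in>cl (walk b 0 ` D \<union> F). w z = conj_by a3 (conj_by (b 3) g) (conj_by a2 (conj_by (b 2) g)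
      (conj_by a1 (conj_by (b 1) g) (conj_by a0 (conj_by (b 0) g) z)))"
    using four_conjugates[OF k(1) k(1) k(1) k(1) k(2) k(2) k(2) k(2) walk_images
        gd[THEN conjunct1] gd[THEN conjunct2] w _ F(2)] agree
    by (force simp: walk_4)
  define a where "a i = (if i < 4 then [a0, a1, a2, a3] ! i else id)" for i
  define b' where "b' i = b i \<circ> a i" for i
  have less4: "i < 4 \<longleftrightarrow> i = 0 \<or> i = 1 \<or> i = 2 \<or> i = 3" for i :: nat by auto
  have a_simps: "a 0 = a0" "a 1 = a1" "a 2 = a2" "a 3 = a3"
    by (simp_all add: a_def eval_nat_numeral)
  have aFix: "a i \<in> Fix (walk b i ` D \<union> walk b (Suc i) ` D)" if "i < 4" for i
  proof -
    have Suc: "Suc 0 = 1" "Suc 1 = 2" "Suc 2 = 3" "Suc 3 = 4" by simp_all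
    show ?thesis
      using that unfolding less4 by (elim disjE; hypsubst) (simp_all only: Suc a_simps a)
  qed
  have aG: "a i \<in> G" for i
    using FixD[OF aFix] by (cases "i < 4") (auto simp: a_def Aut_id)
  have "range b' \<subseteq> G" using b aG by (auto simp: b'_def Aut_comp)
  moreover have "refines b D b' F"
    using F(1) Fix_apply[OF aFix] by (simp add: refines_def b'_def)
  moreover have "walk b' 4 x = w x" if "x \<in> cl F" for x
  proof -
    have "walk b 0 ` D \<union> F = F" using F(1) by auto
    moreover have "conj_by (b' i) g = conj_by (a i) (conj_by (b i) g)" for i
      unfolding b'_def using aG b by (intro conj_by_comp) auto
    ultimately show ?thesis
      using eq that by (simp only: walk_4 a_simps)
  qed
  ultimately show ?thesis by blast
qed

text \<open>Independence along the chain can be enforced because only the two outer conjugates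
  occur in it. The sets at positions 1, 2, 3 are chosen so large that position 1 contains positions
  0 and 1 of the old chain and position 3 contains its positions 3 and 4. The outer conjugators
  are then changed over these large sets, which moves the new sets at positions 0 and 4 freely
  away from position 2 and disturbs nothing of the old chain.\<close>

lemma good_exists:
  assumes b: "range b \<subseteq> G" and D: "finite D"
  shows "\<exists>b' D'. range b' \<subseteq> G \<and> refines b D b' D' \<and> good b' D'"
proof -
  define k where "k i = conj_by (b i) g" for i
  have k: "k i \<in> G" for i using conj_g_Aut[OF b] by (simp add: k_def)
  let ?X = "\<lambda>i. walk b i ` D"
  define Y1 where "Y1 = ?X 0 \<union> ?X 1 \<union> inv (k 1) ` inv (k 2) ` (?X 3 \<union> ?X 4)"
  define Y2 where "Y2 = k 1 ` Y1"
  define Y3 where "Y3 = k 2 ` Y2"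
  have "finite Y1" unfolding Y1_def by (intro finite_UnI finite_imageI D)
  then have fin: "finite Y1" "finite Y2" "finite Y3" by (simp_all add: Y2_def Y3_def)
  have "k 2 ` k 1 ` inv (k 1) ` inv (k 2) ` (?X 3 \<union> ?X 4) = ?X 3 \<union> ?X 4"
    by (simp only: Aut_inv_image(2)[OF k])
  then have Y3: "?X 3 \<union> ?X 4 \<subseteq> Y3"
    unfolding Y3_def Y2_def Y1_def by blast
  obtain e0 where e0: "e0 \<in> Fix Y1" "indep (e0 ` inv (k 0) ` Y1) Y1 Y2"
    using indep_exists[of "inv (k 0) ` Y1" Y1 Y2] fin by blast
  obtain e3 where e3: "e3 \<in> Fix Y3" "indep (e3 ` k 3 ` Y3) Y3 Y2"
    using indep_exists[of "k 3 ` Y3" Y3 Y2] fin by blast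
  have e: "e0 \<in> G" "e3 \<in> G" using e0 e3 FixD by auto
  define b' where "b' = b(0 := b 0 \<circ> inv e0, 3 := b 3 \<circ> inv e3)"
  define D' where "D' = e0 ` inv (k 0) ` Y1"
  have bG: "b i \<in> G" for i using b by auto
  have b': "range b' \<subseteq> G" using bG e by (auto simp: b'_def intro!: Aut_comp Aut_inv)
  have conj_inv: "conj_by (inv u) v = u \<circ> v \<circ> inv u" if "u \<in> G" for u v
    using that by (simp add: conj_by_def inv_inv_eq Aut_bij)
  have k': "conj_by (b' 0) g = e0 \<circ> k 0 \<circ> inv e0" "conj_by (b' 1) g = k 1"
    "conj_by (b' 2) g = k 2" "conj_by (b' 3) g = e3 \<circ> k 3 \<circ> inv e3"
    using e bG by (simp_all add: b'_def k_def conj_by_comp conj_inv Aut_inv)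
  have eY: "e0 ` Y1 = Y1" "inv e3 ` Y3 = Y3"
    using Fix_image[OF e0(1) cl_ext] Fix_image[OF Fix_inv[OF e3(1)] cl_ext] by auto
  have W0: "walk b' 0 ` D' = e0 ` inv (k 0) ` Y1" by (simp add: D'_def)
  have W1: "walk b' 1 ` D' = Y1"
  proof -
    have "walk b' 1 ` D' = e0 ` k 0 ` inv e0 ` e0 ` inv (k 0) ` Y1"
      by (simp only: walk_images k' W0 flip: image_comp)
    then show ?thesis by (simp only: Aut_inv_image[OF e(1)] Aut_inv_image(2)[OF k] eY)
  qed
  have W2: "walk b' 2 ` D' = Y2" by (simp only: walk_images(2) W1 k' Y2_def)
  have W3: "walk b' 3 ` D' = Y3" by (simp only: walk_images(3) W2 k' Y3_def)
  have W4: "walk b' 4 ` D' = e3 ` k 3 ` Y3"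
    by (simp only: walk_images(4) W3 k' eY flip: image_comp)
  have "good b' D'"
    unfolding good_def W0 W1 W2 W3 W4 using e0(2) indep_sym[OF e3(2)] by blast
  moreover have "refines b D b' D'"
    unfolding refines_def
  proof (intro conjI allI impI ballI subsetI)
    fix x assume x: "x \<in> D"
    have "walk b 1 x = k 0 x" by (simp add: k_def)
    then have "k 0 x \<in> Y1" using x by (force simp: Y1_def)
    then have "e0 x \<in> D'"
      using Aut_inv_apply(1)[OF k, of 0 x] unfolding D'_def by (metis imageI)
    moreover have "x \<in> cl Y1" using x cl_ext[of Y1] by (auto simp: Y1_def)
    ultimately show "x \<in> D'" using Fix_apply[OF e0(1)] by simp
  next
    fix i :: nat and x
    assume i: "i < 4" and x: "x \<in> cl (?X i \<union> ?X (Suc i))"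
    show "b' i x = b i x"
    proof -
      consider "i = 0" | "i = 3" | "i \<noteq> 0" "i \<noteq> 3" by blast
      then show ?thesis
      proof cases
        case 1
        have "?X 0 \<union> ?X (Suc 0) \<subseteq> Y1" by (auto simp: Y1_def)
        then have "x \<in> cl Y1" using x 1 cl_mono by blast
        then show ?thesis using 1 Fix_apply[OF Fix_inv[OF e0(1)]] by (simp add: b'_def)
      next
        case 2
        have "?X 3 \<union> ?X (Suc 3) \<subseteq> Y3" using Y3 by (simp add: eval_nat_numeral)
        then have "x \<in> cl Y3" using x 2 cl_mono by blast
        then show ?thesis using 2 Fix_apply[OF Fix_inv[OF e3(1)]] by (simp add: b'_def)
      qed (simp add: b'_def)
    qed
  qed
  ultimately show ?thesis using b' by blast
qed

text \<open>Conjugators converge to a bijection if each point \<open>z\<close> eventually lies in their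
  stable domain and eventually lies in their stable range, hence the two memberships.\<close>

definition absorbed :: "(nat \<Rightarrow> 'a \<Rightarrow> 'a) \<Rightarrow> 'a set \<Rightarrow> 'a \<Rightarrow> bool" where
  "absorbed b D z \<longleftrightarrow> (\<forall>i<4. z \<in> walk b i ` D \<and> inv (b i) z \<in> walk b i ` D)"

lemma refines_absorbed:
  assumes b: "range b \<subseteq> G" and b': "range b' \<subseteq> G" and ref: "refines b D b' D'"
    and abs: "absorbed b D z"
  shows "absorbed b' D' z"
  unfolding absorbed_def
proof (intro allI impI)
  fix i :: nat assume i: "i < 4"
  have sub: "walk b i ` D \<subseteq> walk b' i ` D'"
    using refines_walk_subset[OF b b' ref] i by simp
  let ?y = "inv (b i) z"
  have z: "z \<in> walk b i ` D" and y: "?y \<in> walk b i ` D" using abs i by (auto simp: absorbed_def)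
  have Ab: "b i \<in> G" "b' i \<in> G" using b b' by auto
  have "?y \<in> cl (walk b i ` D \<union> walk b (Suc i) ` D)"
    using y cl_ext[of "walk b i ` D \<union> walk b (Suc i) ` D"] by blast
  then have "b' i ?y = b i ?y" using ref i by (simp add: refines_def)
  then have "b' i ?y = z" using Aut_inv_apply(2)[OF Ab(1)] by simp
  then have "inv (b' i) z = ?y" using Aut_inv_apply(1)[OF Ab(2)] by metis
  then show "z \<in> walk b' i ` D' \<and> inv (b' i) z \<in> walk b' i ` D'" using z y sub by auto
qed

lemma absorb_exists:
  assumes b: "range b \<subseteq> G" and D: "finite D"
  shows "\<exists>D'. finite D' \<and> D \<subseteq> D' \<and> absorbed b D' z"
proof -
  let ?D' = "D \<union> (\<Union>i<4. inv (walk b i) ` {z, inv (b i) z})"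
  have "y \<in> walk b i ` ?D'" if "i < 4" "y \<in> {z, inv (b i) z}" for i y
  proof -
    have "y = walk b i (inv (walk b i) y)" using Aut_inv_apply(2)[OF walk_Aut[OF b, of i]] by simp
    moreover have "inv (walk b i) y \<in> ?D'" using that by blast
    ultimately show ?thesis by (rule image_eqI)
  qed
  then have "absorbed b ?D' z" unfolding absorbed_def by blast
  moreover have "finite ?D'" using D by simp
  ultimately show ?thesis by blast
qed

lemma good_absorbing_exists:
  assumes b: "range b \<subseteq> G" and D: "finite D"
  shows "\<exists>b' D'. range b' \<subseteq> G \<and> refines b D b' D' \<and> good b' D' \<and> absorbed b' D' z"
proof -
  obtain E where E: "finite E" "D \<subseteq> E" "absorbed b E z" using absorb_exists[OF b D] by blast
  then obtain b' D' where "range b' \<subseteq> G" "refines b E b' D'" "good b' D'"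
    using good_exists[OF b] by blast
  moreover from this have "refines b D b' D'" using refines_trans[OF b b refines_same[OF E(2)]] by blast
  ultimately show ?thesis using refines_absorbed[OF b _ _ E(3)] by blast
qed

text \<open>The set \<open>UNIV\<close> in the conclusion expresses that the limit is a refinement of
  every stage, so that the lemmas on refinements apply to it.\<close>

lemma refines_limit:
  assumes b: "\<And>n. range (b n) \<subseteq> G" and ref: "\<And>n. refines (b n) (D n) (b (Suc n)) (D (Suc n))"
    and abs: "\<And>z. \<exists>n. absorbed (b n) (D n) z"
  shows "\<exists>v. range v \<subseteq> G \<and> (\<forall>n. refines (b n) (D n) v UNIV)"
proof -
  let ?S = "\<lambda>i n. cl (walk (b n) i ` D n \<union> walk (b n) (Suc i) ` D n)"
  have "\<exists>v\<in>G. i < 4 \<longrightarrow> (\<forall>n. \<forall>x\<in>?S i n. v x = b n i x)" for i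
  proof (cases "i < 4")
    case i: True
    have in_S: "x \<in> walk (b n) i ` D n \<Longrightarrow> x \<in> ?S i n" for x n
      using cl_ext[of "walk (b n) i ` D n \<union> walk (b n) (Suc i) ` D n"] by blast
    have "\<exists>v\<in>G. \<forall>n. \<forall>x\<in>?S i n. v x = b n i x"
    proof (rule Aut_limit)
      show "b n i \<in> G" for n using b[of n] by auto
      show "?S i n \<subseteq> ?S i (Suc n)" for n using refines_closure_subset[OF b b ref i] .
      show "b (Suc n) i x = b n i x" if "x \<in> ?S i n" for n x
        using ref[of n] i that by (simp add: refines_def)
      show "\<exists>n. z \<in> ?S i n" for z
        using abs[of z] i in_S unfolding absorbed_def by blast
      show "\<exists>n. z \<in> b n i ` ?S i n" for z
      proof -
        obtain n where "inv (b n i) z \<in> ?S i n" using abs[of z] i in_S unfolding absorbed_def by blast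
        moreover have "b n i \<in> G" using b[of n] by auto
        then have "z = b n i (inv (b n i) z)" by simp
        ultimately show ?thesis by blast
      qed
    qed
    then show ?thesis by blast
  qed (use Aut_id in blast)
  then obtain v where "\<And>i. v i \<in> G \<and> (i < 4 \<longrightarrow> (\<forall>n. \<forall>x\<in>?S i n. v i x = b n i x))"
    by metis
  then show ?thesis by (intro exI[of _ v]) (auto simp: refines_def)
qed

section \<open>Eight conjugates, and sixteen\<close>

text \<open>A position of the back and forth: the chain \<open>d\<close> ends where the chain \<open>c\<close> starts, and
  their composite is \<open>f\<close> as far as it is determined. Goodness is required of \<open>c\<close> only, since in
  each round \<open>d\<close> is enlarged first and \<open>c\<close> has to follow.\<close>

definition factoring where
  "factoring f c C d D \<longleftrightarrow> range c \<subseteq> G \<and> range d \<subseteq> G \<and> good c C \<and> finite D \<and>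
     walk d 4 ` D = C \<and> (\<forall>x\<in>cl D. walk c 4 (walk d 4 x) = f x)"

text \<open>Enlarging one chain to a good one that absorbs the point \<^term>\<open>z\<close> prescribes the
  product of the other one on a larger set, namely the quotient of \<^term>\<open>f\<close> by the product of the
  first. The other chain can follow because it was made good before its turn.\<close>

lemma factoring_step:
  assumes f: "f \<in> G" and fac: "factoring f c C d D"
  shows "\<exists>c' C' d' D'. factoring f c' C' d' D' \<and> refines c C c' C' \<and> refines d D d' D' \<and>
    absorbed c' C' z \<and> absorbed d' D' z"
proof -
  have c: "range c \<subseteq> G" and d: "range d \<subseteq> G" and good: "good c C" and D: "finite D"
    and DC: "walk d 4 ` D = C" and prod: "\<forall>x\<in>cl D. walk c 4 (walk d 4 x) = f x"
    using fac by (auto simp: factoring_def)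
  \<comment> \<open>the right-hand chain takes its turn, the left-hand one follows\<close>
  obtain d1 D1 where d1: "range d1 \<subseteq> G" "refines d D d1 D1" "good d1 D1" "absorbed d1 D1 z"
    using good_absorbing_exists[OF d D] by blast
  have d1G: "walk d1 4 \<in> G" using walk_Aut[OF d1(1)] .
  let ?C1 = "walk d1 4 ` D1"
  have C1: "C \<subseteq> ?C1" using refines_walk_subset[OF d d1(1,2), of 4] DC by simp
  have agree1: "(f \<circ> inv (walk d1 4)) x = walk c 4 x" if x: "x \<in> cl C" for x
  proof -
    have "x \<in> walk d 4 ` cl D"
      using x by (simp only: DC[symmetric] cl_image[OF walk_Aut[OF d]])
    then obtain y where y: "x = walk d 4 y" "y \<in> cl D" by (rule imageE)
    then have "inv (walk d1 4) x = y"
      using refines_walk[OF d d1(1,2) y(2), of 4] Aut_inv_apply(1)[OF d1G, of y] by simp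
    then show ?thesis using prod y by simp
  qed
  obtain c1 where c1: "range c1 \<subseteq> G" "refines c C c1 ?C1"
    "\<forall>x\<in>cl ?C1. walk c1 4 x = (f \<circ> inv (walk d1 4)) x"
    using good_extend[OF c good C1 _ Aut_comp[OF f Aut_inv[OF d1G]] agree1] good_finite[OF d1(3)]
    by blast
  \<comment> \<open>the left-hand chain takes its turn, the right-hand one follows\<close>
  obtain c2 C2 where c2: "range c2 \<subseteq> G" "refines c1 ?C1 c2 C2" "good c2 C2" "absorbed c2 C2 z"
    using good_absorbing_exists[OF c1(1)] good_finite[OF d1(3)] by blast
  have c2G: "walk c2 4 \<in> G" using walk_Aut[OF c2(1)] .
  let ?w = "inv (walk c2 4) \<circ> f"
  have wG: "?w \<in> G" using c2G f by (simp add: Aut_comp Aut_inv)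
  have agree2: "?w x = walk d1 4 x" if x: "x \<in> cl D1" for x
  proof -
    have y: "walk d1 4 x \<in> cl ?C1" using walk_cl[OF d1(1) x] .
    have "walk c2 4 (walk d1 4 x) = f x"
      using refines_walk[OF c1(1) c2(1,2) y, of 4] c1(3) y Aut_inv_apply(1)[OF d1G] by simp
    then show ?thesis using Aut_inv_apply(1)[OF c2G, of "walk d1 4 x"] by simp
  qed
  let ?D2 = "inv ?w ` C2"
  have "?w ` D1 = ?C1" using agree2 cl_ext[of D1] by (intro image_cong) auto
  then have "?w ` D1 \<subseteq> C2" using c2(2) by (simp add: refines_def)
  then have "inv ?w ` ?w ` D1 \<subseteq> ?D2" by (rule image_mono)
  then have D2: "D1 \<subseteq> ?D2" by (simp only: Aut_inv_image(1)[OF wG])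
  have finD2: "finite ?D2" using good_finite[OF c2(3)] by simp
  obtain d2 where d2: "range d2 \<subseteq> G" "refines d1 D1 d2 ?D2" "\<forall>x\<in>cl ?D2. walk d2 4 x = ?w x"
    using good_extend[OF d1(1,3) D2 finD2 wG agree2] by blast
  have "walk d2 4 ` ?D2 = ?w ` ?D2" using d2(3) cl_ext[of ?D2] by (intro image_cong) auto
  then have "walk d2 4 ` ?D2 = C2" by (simp only: Aut_inv_image(2)[OF wG])
  moreover have "walk c2 4 (walk d2 4 x) = f x" if "x \<in> cl ?D2" for x
    using d2(3) that Aut_inv_apply(2)[OF c2G] by simp
  ultimately have "factoring f c2 C2 d2 ?D2"
    using c2 d2 finD2 by (simp add: factoring_def)
  moreover have "refines c C c2 C2" using refines_trans[OF c c1(1,2) c2(2)] .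
  moreover have "refines d D d2 ?D2" using refines_trans[OF d d1(1,2) d2(2)] .
  moreover have "absorbed d2 ?D2 z" using refines_absorbed[OF d1(1) d2(1,2) d1(4)] .
  ultimately show ?thesis using c2(4) by blast
qed

text \<open>In the limit the composite is \<^term>\<open>f\<close> everywhere, because an absorbed point lies in the
  starting set of the chain \<open>d\<close>, where the composite has already been fixed.\<close>

lemma eight_conjugates:
  assumes f: "f \<in> G" and e: "surj (e :: nat \<Rightarrow> 'a)"
    and fixes_cl_empty: "\<forall>u\<in>G. \<forall>x\<in>cl {}. u x = x"
  shows "\<exists>c d. range c \<subseteq> G \<and> range d \<subseteq> G \<and> f = walk c 4 \<circ> walk d 4"
proof -
  let ?fac = "\<lambda>(c, C, d, D). factoring f c C d D"
  let ?step = "\<lambda>n (c, C, d, D) (c', C', d', D'). refines c C c' C' \<and> refines d D d' D' \<and>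
    absorbed c' C' (e n) \<and> absorbed d' D' (e n)"
  have start: "factoring f (\<lambda>_. id) {} (\<lambda>_. id) {}"
  proof -
    have r: "range (\<lambda>_::nat. id) \<subseteq> G" by (auto simp: Aut_id)
    have "good (\<lambda>_. id) {}" using indep_over_self[of "{}" "{}"] by (simp add: good_def)
    moreover have "walk (\<lambda>_. id) 4 (walk (\<lambda>_. id) 4 x) = f x" if x: "x \<in> cl {}" for x
    proof -
      have "walk (\<lambda>_. id) 4 x = x" using fixes_cl_empty walk_Aut[OF r, of 4] x by blast
      moreover have "f x = x" using fixes_cl_empty f x by blast
      ultimately show ?thesis by simp
    qed
    ultimately show ?thesis using r by (simp add: factoring_def)
  qed
  have "\<exists>s. \<forall>n. ?fac (s n) \<and> ?step n (s n) (s (Suc n))"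
  proof (rule dependent_nat_choice)
    show "\<exists>s. ?fac s" using start by auto
    show "\<exists>s'. ?fac s' \<and> ?step n s s'" if "?fac s" for s n
      using factoring_step[OF f, of _ _ _ _ "e n"] that by (auto split: prod.splits)
  qed
  then obtain s where all: "\<forall>n. ?fac (s n) \<and> ?step n (s n) (s (Suc n))" by (rule exE)
  have s: "?fac (s n)" "?step n (s n) (s (Suc n))" for n
    using all[rule_format, of n] by (rule conjunct1, rule conjunct2)
  define c where "c n = fst (s n)" for n
  define C where "C n = fst (snd (s n))" for n
  define d where "d n = fst (snd (snd (s n)))" for n
  define D where "D n = snd (snd (snd (s n)))" for n
  have sn: "s n = (c n, C n, d n, D n)" for n by (simp add: c_def C_def d_def D_def)
  have fac: "factoring f (c n) (C n) (d n) (D n)" for n using s(1)[of n] by (simp add: sn)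
  have ref: "refines (c n) (C n) (c (Suc n)) (C (Suc n))" "refines (d n) (D n) (d (Suc n)) (D (Suc n))"
    and abs: "absorbed (c (Suc n)) (C (Suc n)) (e n)" "absorbed (d (Suc n)) (D (Suc n)) (e n)" for n
    using s(2)[of n] by (simp_all add: sn)
  have cG: "range (c n) \<subseteq> G" and dG: "range (d n) \<subseteq> G" for n
    using fac[of n] by (simp_all add: factoring_def)
  have ez: "\<exists>n. z = e n" for z using e by (auto simp: surj_def)
  obtain c' where c': "range c' \<subseteq> G" "\<And>n. refines (c n) (C n) c' UNIV"
    using refines_limit[of c C] cG ref abs ez by metis
  obtain d' where d': "range d' \<subseteq> G" "\<And>n. refines (d n) (D n) d' UNIV"
    using refines_limit[of d D] dG ref abs ez by metis
  have "f x = walk c' 4 (walk d' 4 x)" for x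
  proof -
    obtain n where n: "x = e n" using ez by blast
    have "x \<in> walk (d (Suc n)) 0 ` D (Suc n)"
      using abs(2)[of n, unfolded absorbed_def, rule_format, of 0] n by simp
    then have x: "x \<in> cl (D (Suc n))" using cl_ext by auto
    have "walk (d (Suc n)) 4 x \<in> cl (walk (d (Suc n)) 4 ` D (Suc n))" using walk_cl[OF dG x] .
    then have y: "walk (d (Suc n)) 4 x \<in> cl (C (Suc n))"
      using fac[of "Suc n"] by (simp add: factoring_def)
    have "f x = walk (c (Suc n)) 4 (walk (d (Suc n)) 4 x)"
      using fac[of "Suc n"] x by (simp add: factoring_def)
    also have "\<dots> = walk c' 4 (walk (d (Suc n)) 4 x)"
      using refines_walk[OF cG c'(1) c'(2) y, of 4] by simp
    also have "\<dots> = walk c' 4 (walk d' 4 x)"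
      using refines_walk[OF dG d'(1) d'(2) x, of 4] by simp
    finally show ?thesis .
  qed
  then have "f = walk c' 4 \<circ> walk d' 4" by auto
  then show ?thesis using c'(1) d'(1) by blast
qed

lemma walk_conjugates:
  assumes b: "range b \<subseteq> G"
  shows "\<exists>cs. length cs = n \<and> set cs \<subseteq> conjugates M g \<and> walk b n = foldr (\<circ>) cs id"
proof (induction n)
  case (Suc n)
  then obtain cs where cs: "length cs = n" "set cs \<subseteq> conjugates M g" "walk b n = foldr (\<circ>) cs id"
    by blast
  have bG: "b n \<in> G" using b by auto
  then have "conj_by (b n) g = inv (b n) \<circ> g \<circ> inv (inv (b n))"
    by (simp add: conj_by_def inv_inv_eq Aut_bij)
  then have "conj_by (b n) g \<in> conjugates M g"
    using Aut_inv[OF bG] unfolding conjugates_def by blast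
  then show ?case
    using cs(1,2) by (intro exI[of _ "conj_by (b n) g # cs"] conjI)
      (simp, simp, simp only: walk.simps foldr.simps comp_apply[of "(\<circ>) (conj_by (b n) g)"] cs(3))
qed simp

end

lemma foldr_comp_append: "foldr (\<circ>) (xs @ ys) id = foldr (\<circ>) xs id \<circ> foldr (\<circ>) ys id"
  by (induction xs) (simp_all add: comp_assoc)

theorem theorem2p7:
  fixes M :: "('a :: countable, 'f, 'r) fo_structure"
    and cl :: "'a set \<Rightarrow> 'a set"
    and ind :: "'a set \<Rightarrow> 'a set \<Rightarrow> 'a set \<Rightarrow> bool"
    and g :: "'a \<Rightarrow> 'a"
  assumes "closure_operation cl"
    and "invariant_closure M cl"
    and "finitary_closure cl"
    and "subsumes_dcl M cl"
    and "stationary_independence M cl ind"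
    and "\<forall>u\<in>Aut M. \<forall>x\<in>cl {}. u x = x"
    and "g \<in> Aut M"
    and "moves_almost_maximally M cl ind g"
  shows "\<forall>f\<in>Aut M. \<exists>cs. length cs = 16 \<and> set cs \<subseteq> conjugates M g \<and> f = foldr (\<circ>) cs id"
proof
  fix f assume f: "f \<in> Aut M"
  interpret independent_structure M cl ind using assms(1,2,5) by unfold_locales
  interpret maximal_mover M cl ind g
    using assms(7) moves_maximallyI[OF assms(7,8)] by unfold_locales
  have r: "range (\<lambda>_::nat. id) \<subseteq> Aut M" by (auto simp: Aut_id)
  \<comment> \<open>the eighth power of \<^term>\<open>g\<close>, supplying the last eight of the sixteen conjugates\<close>
  let ?p = "walk (\<lambda>_. id) 8"
  have p: "?p \<in> Aut M" using walk_Aut[OF r] .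
  obtain c d where c: "range c \<subseteq> Aut M" and d: "range d \<subseteq> Aut M"
    and cd: "f \<circ> inv ?p = walk c 4 \<circ> walk d 4"
    using eight_conjugates[OF Aut_comp[OF f Aut_inv[OF p]] surj_from_nat assms(6)] by blast
  obtain xs where xs: "length xs = 4" "set xs \<subseteq> conjugates M g" "walk c 4 = foldr (\<circ>) xs id"
    using walk_conjugates[OF c] by blast
  obtain ys where ys: "length ys = 4" "set ys \<subseteq> conjugates M g" "walk d 4 = foldr (\<circ>) ys id"
    using walk_conjugates[OF d] by blast
  obtain zs where zs: "length zs = 8" "set zs \<subseteq> conjugates M g" "?p = foldr (\<circ>) zs id"
    using walk_conjugates[OF r] by blast
  have "f = (f \<circ> inv ?p) \<circ> ?p" using p by (auto simp: fun_eq_iff)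
  also have "\<dots> = (walk c 4 \<circ> walk d 4) \<circ> ?p" by (simp only: cd)
  also have "\<dots> = foldr (\<circ>) (xs @ ys @ zs) id"
    by (simp only: foldr_comp_append xs(3) ys(3) zs(3) comp_assoc)
  finally show "\<exists>cs. length cs = 16 \<and> set cs \<subseteq> conjugates M g \<and> f = foldr (\<circ>) cs id"
    using xs ys zs by (intro exI[of _ "xs @ ys @ zs"]) simp
qed

end
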